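(* The functor $\mathsf{cone}\colon\mathbf{rosLoc}\to\triangledown\mathbf{Frm}^{\mathrm{op}}$ is left adjoint to the functor $\mathsf{rel}\colon\triangledown\mathbf{Frm}^{\mathrm{op}}\to\mathbf{rosLoc}$, and the counit of the adjunction $\mathsf{cone}\dashv\mathsf{rel}$ is the identity.
   Context: $\mathbf{Loc}=\mathbf{Frm}^{\mathrm{op}}$; a locale $X$ has frame of opens $\mathcal{O}X$, and a locale map $f\colon X\to Y$ is a frame map $f^{-1}\colon\mathcal{O}Y\to\mathcal{O}X$. A sublocale is an (equivalence class of an) extremal monomorphism in $\mathbf{Loc}$, equivalently a frame congruence. $\mathcal{O}(X\times X)=\mathcal{O}X\otimes\mathcal{O}X$ is the frame coproduct, generated under joins by rectangles $x\otimes y$. A localic relation on $X$ is a sublocale $r\colon R\rightarrowtail X\times X$, with source $s=\mathrm{pr}_1 r$ and target $t=\mathrm{pr}_2 r$. A map $f\colon(X,R)\to(Y,Q)$ is monotone if $f$ is a locale map $X\to Y$ such that $f\times f$ restricts to a (necessarily unique) map $\bar f\colon R\to Q$. A locale map $f$ is open if $f^{-1}$ has a left adjoint $f_!$ with $f_!(U\wedge f^{-1}(V))=f_!(U)\wedge V$. $R$ has open source if $s$ is open, and then its induced cone is $\Downarrow_R:=s_!\circ t^{-1}\colon\mathcal{O}X\to\mathcal{O}X$. $\mathbf{rosLoc}$ is the category of locales equipped with open source localic relations, and monotone maps. A conic frame $(L,\triangledown)$ is a frame $L$ with a join-preserving function $\triangledown\colon L\to L$. A conic morphism $h\colon(L,\triangledown)\to(M,\triangledown')$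 is a frame map with $\triangledown'\circ h\le h\circ\triangledown$. $\triangledown\mathbf{Frm}$ is the category of conic frames and conic morphisms. For a conic frame $(\mathcal{O}X,\triangledown)$, the induced relation $R_\triangledown$ is the sublocale of $X\times X$ given by the smallest frame congruence on $\mathcal{O}X\otimes\mathcal{O}X$ identifying $x\otimes y$ with $(x\wedge\triangledown y)\otimes y$ for all $x,y\in\mathcal{O}X$; it has open source. $\mathsf{cone}(X,R)=(\mathcal{O}X,\Downarrow_R)$ and $\mathsf{cone}(f)=f^{-1}$. $\mathsf{rel}(\mathcal{O}X,\triangledown)=(X,R_\triangledown)$ and $\mathsf{rel}(f^{-1})=f$. *)

theory Defs
  imports "HOL-Algebra.Galois_Connection"
begin

section \<open>Categories, functors and adjunctions\<close>

text \<open>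
  Arrows need not determine their domain and codomain, so composition and the action of a functor
  on arrows also take the objects involved: \<open>Comp C A B D g f\<close> is the composite of
  \<open>f : A \<rightarrow> B\<close> and \<open>g : B \<rightarrow> D\<close>.
\<close>

record ('o, 'm) cat_data =
  Obj :: "'o set"
  Hom :: "'o \<Rightarrow> 'o \<Rightarrow> 'm set"
  Ident :: "'o \<Rightarrow> 'm"
  Comp :: "'o \<Rightarrow> 'o \<Rightarrow> 'o \<Rightarrow> 'm \<Rightarrow> 'm \<Rightarrow> 'm"

definition is_category :: "('o, 'm) cat_data \<Rightarrow> bool" where
  "is_category C \<longleftrightarrow>
     (\<forall>A\<in>Obj C. Ident C A \<in> Hom C A A) \<and>
     (\<forall>A\<in>Obj C. \<forall>B\<in>Obj C. \<forall>D\<in>Obj C. \<forall>f\<in>Hom C A B. \<forall>g\<in>Hom C B D.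
        Comp C A B D g f \<in> Hom C A D) \<and>
     (\<forall>A\<in>Obj C. \<forall>B\<in>Obj C. \<forall>f\<in>Hom C A B.
        Comp C A A B f (Ident C A) = f \<and> Comp C A B B (Ident C B) f = f) \<and>
     (\<forall>A\<in>Obj C. \<forall>B\<in>Obj C. \<forall>D\<in>Obj C. \<forall>E\<in>Obj C.
        \<forall>f\<in>Hom C A B. \<forall>g\<in>Hom C B D. \<forall>h\<in>Hom C D E.
        Comp C A D E h (Comp C A B D g f) = Comp C A B E (Comp C B D E h g) f)"

definition opposite :: "('o, 'm) cat_data \<Rightarrow> ('o, 'm) cat_data" where
  "opposite C =
     \<lparr>Obj = Obj C, Hom = (\<lambda>A B. Hom C B A), Ident = Ident C,
      Comp = (\<lambda>A B D g f. Comp C D B A f g)\<rparr>"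

record ('o, 'm, 'p, 'n) functor_data =
  on_obj :: "'o \<Rightarrow> 'p"
  on_hom :: "'o \<Rightarrow> 'o \<Rightarrow> 'm \<Rightarrow> 'n"

definition is_functor ::
  "('o, 'm) cat_data \<Rightarrow> ('p, 'n) cat_data \<Rightarrow> ('o, 'm, 'p, 'n) functor_data \<Rightarrow> bool" where
  "is_functor C D F \<longleftrightarrow> is_category C \<and> is_category D \<and>
     (\<forall>A\<in>Obj C. on_obj F A \<in> Obj D) \<and>
     (\<forall>A\<in>Obj C. \<forall>B\<in>Obj C. \<forall>f\<in>Hom C A B.
        on_hom F A B f \<in> Hom D (on_obj F A) (on_obj F B)) \<and>
     (\<forall>A\<in>Obj C. on_hom F A A (Ident C A) = Ident D (on_obj F A)) \<and>
     (\<forall>A\<in>Obj C. \<forall>B\<in>Obj C. \<forall>E\<in>Obj C. \<forall>f\<in>Hom C A B. \<forall>g\<in>Hom C B E.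
        on_hom F A E (Comp C A B E g f) =
        Comp D (on_obj F A) (on_obj F B) (on_obj F E) (on_hom F B E g) (on_hom F A B f))"

definition id_functor :: "('o, 'm, 'o, 'm) functor_data" where
  "id_functor = \<lparr>on_obj = (\<lambda>A. A), on_hom = (\<lambda>A B f. f)\<rparr>"

definition comp_functor ::
  "('p, 'n, 'q, 'k) functor_data \<Rightarrow> ('o, 'm, 'p, 'n) functor_data \<Rightarrow> ('o, 'm, 'q, 'k) functor_data"
  where
  "comp_functor G F =
     \<lparr>on_obj = (\<lambda>A. on_obj G (on_obj F A)),
      on_hom = (\<lambda>A B f. on_hom G (on_obj F A) (on_obj F B) (on_hom F A B f))\<rparr>"

definition functors_agree ::
  "('o, 'm) cat_data \<Rightarrow> ('o, 'm, 'p, 'n) functor_data \<Rightarrow> ('o, 'm, 'p, 'n) functor_data \<Rightarrow> bool"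
  where
  "functors_agree C F G \<longleftrightarrow>
     (\<forall>A\<in>Obj C. on_obj F A = on_obj G A) \<and>
     (\<forall>A\<in>Obj C. \<forall>B\<in>Obj C. \<forall>f\<in>Hom C A B. on_hom F A B f = on_hom G A B f)"

definition is_natural ::
  "('o, 'm) cat_data \<Rightarrow> ('p, 'n) cat_data \<Rightarrow>
   ('o, 'm, 'p, 'n) functor_data \<Rightarrow> ('o, 'm, 'p, 'n) functor_data \<Rightarrow> ('o \<Rightarrow> 'n) \<Rightarrow> bool" where
  "is_natural C D F G \<tau> \<longleftrightarrow>
     (\<forall>A\<in>Obj C. \<tau> A \<in> Hom D (on_obj F A) (on_obj G A)) \<and>
     (\<forall>A\<in>Obj C. \<forall>B\<in>Obj C. \<forall>f\<in>Hom C A B.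
        Comp D (on_obj F A) (on_obj F B) (on_obj G B) (\<tau> B) (on_hom F A B f) =
        Comp D (on_obj F A) (on_obj G A) (on_obj G B) (on_hom G A B f) (\<tau> A))"

text \<open>The adjunction of \<open>F : C \<rightarrow> D\<close> (left) and \<open>G : D \<rightarrow> C\<close> (right) with unit \<open>\<eta>\<close> and counit \<open>\<epsilon>\<close>.\<close>

definition is_adjunction ::
  "('o, 'm) cat_data \<Rightarrow> ('p, 'n) cat_data \<Rightarrow>
   ('o, 'm, 'p, 'n) functor_data \<Rightarrow> ('p, 'n, 'o, 'm) functor_data \<Rightarrow>
   ('o \<Rightarrow> 'm) \<Rightarrow> ('p \<Rightarrow> 'n) \<Rightarrow> bool" where
  "is_adjunction C D F G \<eta> \<epsilon> \<longleftrightarrow>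
     is_functor C D F \<and> is_functor D C G \<and>
     is_natural C C id_functor (comp_functor G F) \<eta> \<and>
     is_natural D D (comp_functor F G) id_functor \<epsilon> \<and>
     (\<forall>A\<in>Obj C.
        Comp D (on_obj F A) (on_obj F (on_obj G (on_obj F A))) (on_obj F A)
          (\<epsilon> (on_obj F A)) (on_hom F A (on_obj G (on_obj F A)) (\<eta> A))
        = Ident D (on_obj F A)) \<and>
     (\<forall>B\<in>Obj D.
        Comp C (on_obj G B) (on_obj G (on_obj F (on_obj G B))) (on_obj G B)
          (on_hom G (on_obj F (on_obj G B)) B (\<epsilon> B)) (\<eta> (on_obj G B))
        = Ident C (on_obj G B))"


section \<open>Frames and open locale maps\<close>

locale frame = complete_lattice L for L (structure) +
  assumes meet_Sup_distrib:
    "\<lbrakk>x \<in> carrier L; A \<subseteq> carrier L\<rbrakk> \<Longrightarrow> x \<sqinter> (\<Squnion>A) = \<Squnion>((\<lambda>a. x \<sqinter> a) ` A)"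

text \<open>
  Maps between carriers are taken extensional (\<open>undefined\<close> off the carrier), so that equality of
  HOL functions is equality of maps.
\<close>

definition frame_homs :: "'a gorder \<Rightarrow> 'b gorder \<Rightarrow> ('a \<Rightarrow> 'b) set" where
  "frame_homs L M =
     {h \<in> carrier L \<rightarrow>\<^sub>E carrier M. sup_pres L M h \<and> meet_pres L M h \<and> h \<top>\<^bsub>L\<^esub> = \<top>\<^bsub>M\<^esub>}"

text \<open>\<open>h\<close> is the inverse image \<open>\<O>Y \<rightarrow> \<O>X\<close> of a locale map, with \<open>L = \<O>Y\<close> and \<open>M = \<O>X\<close>.\<close>

definition open_locale_map :: "'a gorder \<Rightarrow> 'b gorder \<Rightarrow> ('a \<Rightarrow> 'b) \<Rightarrow> bool" where
  "open_locale_map L M h \<longleftrightarrow> h \<in> frame_homs L M \<and>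
     (\<exists>g. galois_connection \<lparr>orderA = M, orderB = L, lower = g, upper = h\<rparr> \<and>
        (\<forall>u\<in>carrier M. \<forall>v\<in>carrier L. g (u \<sqinter>\<^bsub>M\<^esub> h v) = g u \<sqinter>\<^bsub>L\<^esub> v))"

definition left_adjoint :: "'a gorder \<Rightarrow> 'b gorder \<Rightarrow> ('a \<Rightarrow> 'b) \<Rightarrow> 'b \<Rightarrow> 'a" where
  "left_adjoint L M h =
     (THE g. g \<in> extensional (carrier M) \<and>
        galois_connection \<lparr>orderA = M, orderB = L, lower = g, upper = h\<rparr>)"


section \<open>Frame coproducts\<close>

text \<open>
  The coproduct of frames is realised in the standard way: its elements are the down-closed
  subsets of \<open>L \<times> M\<close> that are closed under joins in each variable separately (including empty
  joins), ordered by inclusion.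
\<close>

definition coprod_ideal :: "'a gorder \<Rightarrow> 'b gorder \<Rightarrow> ('a \<times> 'b) set \<Rightarrow> bool" where
  "coprod_ideal L M D \<longleftrightarrow> D \<subseteq> carrier L \<times> carrier M \<and>
     (\<forall>(x, y)\<in>D. \<forall>x'\<in>carrier L. \<forall>y'\<in>carrier M.
        x' \<sqsubseteq>\<^bsub>L\<^esub> x \<and> y' \<sqsubseteq>\<^bsub>M\<^esub> y \<longrightarrow> (x', y') \<in> D) \<and>
     (\<forall>A\<subseteq>carrier L. \<forall>y\<in>carrier M. A \<times> {y} \<subseteq> D \<longrightarrow> (\<Squnion>\<^bsub>L\<^esub>A, y) \<in> D) \<and>
     (\<forall>x\<in>carrier L. \<forall>B\<subseteq>carrier M. {x} \<times> B \<subseteq> D \<longrightarrow> (x, \<Squnion>\<^bsub>M\<^esub>B) \<in> D)"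

definition coprod :: "'a gorder \<Rightarrow> 'b gorder \<Rightarrow> ('a \<times> 'b) set gorder" where
  "coprod L M = \<lparr>carrier = {D. coprod_ideal L M D}, eq = (=), le = (\<subseteq>)\<rparr>"

text \<open>The rectangle \<open>x \<otimes> y\<close>.\<close>

definition rect :: "'a gorder \<Rightarrow> 'b gorder \<Rightarrow> 'a \<Rightarrow> 'b \<Rightarrow> ('a \<times> 'b) set" where
  "rect L M x y = \<Inter>{D \<in> carrier (coprod L M). (x, y) \<in> D}"

text \<open>
  The inverse image of \<open>f \<times> g\<close>, i.e. the frame map with \<open>x \<otimes> y \<mapsto> h x \<otimes> k y\<close>, where \<open>h\<close> and \<open>k\<close>
  are the inverse images of \<open>f\<close> and \<open>g\<close>.
\<close>

definition coprod_map ::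
  "'a gorder \<Rightarrow> 'b gorder \<Rightarrow> 'c gorder \<Rightarrow> 'd gorder \<Rightarrow>
   ('a \<Rightarrow> 'c) \<Rightarrow> ('b \<Rightarrow> 'd) \<Rightarrow> ('a \<times> 'b) set \<Rightarrow> ('c \<times> 'd) set" where
  "coprod_map L M L' M' h k =
     (\<lambda>D\<in>carrier (coprod L M). \<Squnion>\<^bsub>coprod L' M'\<^esub>{rect L' M' (h x) (k y) | x y. (x, y) \<in> D})"


section \<open>Sublocales as frame congruences\<close>

definition frame_congruence :: "'a gorder \<Rightarrow> ('a \<times> 'a) set \<Rightarrow> bool" where
  "frame_congruence L \<theta> \<longleftrightarrow> equiv (carrier L) \<theta> \<and>
     (\<forall>(a, b)\<in>\<theta>. \<forall>(c, d)\<in>\<theta>. (a \<sqinter>\<^bsub>L\<^esub> c, b \<sqinter>\<^bsub>L\<^esub> d) \<in> \<theta>) \<and>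
     (\<forall>S\<subseteq>\<theta>. (\<Squnion>\<^bsub>L\<^esub>(fst ` S), \<Squnion>\<^bsub>L\<^esub>(snd ` S)) \<in> \<theta>)"

text \<open>The frame of opens of the sublocale, and the inverse image of its inclusion.\<close>

definition quot_frame :: "'a gorder \<Rightarrow> ('a \<times> 'a) set \<Rightarrow> 'a set gorder" where
  "quot_frame L \<theta> =
     \<lparr>carrier = carrier L // \<theta>, eq = (=), le = (\<lambda>A B. \<exists>a\<in>A. \<exists>b\<in>B. a \<sqsubseteq>\<^bsub>L\<^esub> b)\<rparr>"

definition quot_map :: "'a gorder \<Rightarrow> ('a \<times> 'a) set \<Rightarrow> 'a \<Rightarrow> 'a set" where
  "quot_map L \<theta> = (\<lambda>a\<in>carrier L. \<theta> `` {a})"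

definition least_frame_congruence :: "'a gorder \<Rightarrow> ('a \<times> 'a) set \<Rightarrow> ('a \<times> 'a) set" where
  "least_frame_congruence L S = \<Inter>{\<theta>. frame_congruence L \<theta> \<and> S \<subseteq> \<theta>}"


section \<open>Open source localic relations\<close>

text \<open>
  A localic relation on \<open>X\<close> is a frame congruence \<open>R\<close> on \<open>\<O>X \<otimes> \<O>X\<close>. Below, \<open>L = \<O>X\<close>, and source
  and target are given by their inverse images.
\<close>

type_synonym 'a lrel = "(('a \<times> 'a) set \<times> ('a \<times> 'a) set) set"

abbreviation rel_frame :: "'a gorder \<Rightarrow> 'a lrel \<Rightarrow> ('a \<times> 'a) set set gorder" where
  "rel_frame L R \<equiv> quot_frame (coprod L L) R"

definition source :: "'a gorder \<Rightarrow> 'a lrel \<Rightarrow> 'a \<Rightarrow> ('a \<times> 'a) set set" where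
  "source L R = (\<lambda>x\<in>carrier L. quot_map (coprod L L) R (rect L L x \<top>\<^bsub>L\<^esub>))"

definition target :: "'a gorder \<Rightarrow> 'a lrel \<Rightarrow> 'a \<Rightarrow> ('a \<times> 'a) set set" where
  "target L R = (\<lambda>y\<in>carrier L. quot_map (coprod L L) R (rect L L \<top>\<^bsub>L\<^esub> y))"

definition open_source :: "'a gorder \<Rightarrow> 'a lrel \<Rightarrow> bool" where
  "open_source L R \<longleftrightarrow> open_locale_map L (rel_frame L R) (source L R)"

definition induced_cone :: "'a gorder \<Rightarrow> 'a lrel \<Rightarrow> 'a \<Rightarrow> 'a" where
  "induced_cone L R =
     compose (carrier L) (left_adjoint L (rel_frame L R) (source L R)) (target L R)"

text \<open>
  \<open>f : (X, R) \<rightarrow> (Y, Q)\<close> is monotone: with \<open>h\<close> the inverse image of \<open>f\<close>, \<open>L = \<O>X\<close> and \<open>M = \<O>Y\<close>, the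
  map \<open>g\<close> is the inverse image of the restriction \<open>R \<rightarrow> Q\<close> of \<open>f \<times> f\<close>.
\<close>

definition monotone_map :: "'a gorder \<Rightarrow> 'a lrel \<Rightarrow> 'b gorder \<Rightarrow> 'b lrel \<Rightarrow> ('b \<Rightarrow> 'a) \<Rightarrow> bool" where
  "monotone_map L R M Q h \<longleftrightarrow> h \<in> frame_homs M L \<and>
     (\<exists>g\<in>frame_homs (rel_frame M Q) (rel_frame L R). \<forall>u\<in>carrier (coprod M M).
        g (quot_map (coprod M M) Q u) = quot_map (coprod L L) R (coprod_map M M L L h h u))"

definition rosLoc :: "('a gorder \<times> 'a lrel, 'a \<Rightarrow> 'a) cat_data" where
  "rosLoc =
     \<lparr>Obj = {(L, R). frame L \<and> frame_congruence (coprod L L) R \<and> open_source L R},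
      Hom = (\<lambda>(L, R) (M, Q). {h. monotone_map L R M Q h}),
      Ident = (\<lambda>(L, R). \<lambda>x\<in>carrier L. x),
      Comp = (\<lambda>A B D g f. compose (carrier (fst D)) f g)\<rparr>"


section \<open>Conic frames\<close>

definition conic_frame :: "'a gorder \<Rightarrow> ('a \<Rightarrow> 'a) \<Rightarrow> bool" where
  "conic_frame L c \<longleftrightarrow> frame L \<and> c \<in> carrier L \<rightarrow>\<^sub>E carrier L \<and> sup_pres L L c"

definition conicFrm :: "('a gorder \<times> ('a \<Rightarrow> 'a), 'a \<Rightarrow> 'a) cat_data" where
  "conicFrm =
     \<lparr>Obj = {(L, c). conic_frame L c},
      Hom = (\<lambda>(L, c) (M, d). {h \<in> frame_homs L M. \<forall>x\<in>carrier L. d (h x) \<sqsubseteq>\<^bsub>M\<^esub> h (c x)}),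
      Ident = (\<lambda>(L, c). \<lambda>x\<in>carrier L. x),
      Comp = (\<lambda>A B D g f. compose (carrier (fst A)) g f)\<rparr>"

definition induced_relation :: "'a gorder \<Rightarrow> ('a \<Rightarrow> 'a) \<Rightarrow> 'a lrel" where
  "induced_relation L c =
     least_frame_congruence (coprod L L)
       {(rect L L x y, rect L L (x \<sqinter>\<^bsub>L\<^esub> c y) y) | x y. x \<in> carrier L \<and> y \<in> carrier L}"


section \<open>The two functors\<close>

text \<open>
  Arrows of \<^const>\<open>rosLoc\<close> are already represented by inverse images, hence both functors act
  identically on the representing functions.
\<close>

definition cone_functor ::
  "('a gorder \<times> 'a lrel, 'a \<Rightarrow> 'a, 'a gorder \<times> ('a \<Rightarrow> 'a), 'a \<Rightarrow> 'a) functor_data" where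
  "cone_functor =
     \<lparr>on_obj = (\<lambda>(L, R). (L, induced_cone L R)), on_hom = (\<lambda>A B f. f)\<rparr>"

definition rel_functor ::
  "('a gorder \<times> ('a \<Rightarrow> 'a), 'a \<Rightarrow> 'a, 'a gorder \<times> 'a lrel, 'a \<Rightarrow> 'a) functor_data" where
  "rel_functor =
     \<lparr>on_obj = (\<lambda>(L, c). (L, induced_relation L c)), on_hom = (\<lambda>A B f. f)\<rparr>"

end

theory Submission
  imports Defs
begin

text \<open>
  For an open source relation \<open>R\<close> on \<open>X\<close>, the adjunction between \<open>s\<^sub>!\<close> and the inverse image of \<open>s\<close>
  says that \<open>cone y \<sqsubseteq> z\<close> holds iff the rectangles \<open>\<top> \<otimes> y\<close> and \<open>z \<otimes> y\<close> are identified in \<open>R\<close>. Taking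
  \<open>z = cone y\<close>, the generators of the relation induced by \<open>cone\<close> lie in \<open>R\<close>, which makes the identity
  the unit; applying a monotone map to this pair of rectangles shows that it is a conic morphism.

  Conversely, for a conic frame \<open>(L, c)\<close> the join-preserving map \<open>e\<close> on the coproduct with
  \<open>e (x \<otimes> y) = x \<sqinter> c y\<close> respects the induced relation, because the largest congruence contained in
  the kernel of \<open>e\<close> contains the generators. It descends to \<open>s\<^sub>!\<close>, so the source is open and the induced
  cone is \<open>y \<mapsto> e (\<top> \<otimes> y) = c y\<close>.
\<close>

section \<open>Lattice preliminaries\<close>

text \<open>The map \<open>e\<close> preserves joins but in general not binary meets, so its kernel
  cannot be expected to be a congruence. Testing
  \<open>e (u \<sqinter> w) = e (v \<sqinter> w)\<close> against every \<open>w\<close> repairs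
  this; that the generators pass the test rests on monotonicity of \<open>c\<close> and on the
  idempotence \<open>(p \<sqinter> c q) \<sqinter> c q = p \<sqinter> c q\<close>. A conic morphism
  satisfies only an inequality, so it need not send generators to generators. Functoriality of rel
  therefore uses that congruence classes are order-convex. Joins of ideals have no convenient
  membership criterion, so elements are mostly compared through their upper bounds, which turns
  joins, rectangles and lower adjoints into conditions on pairs. Unit and counit are both carried by
  identity functions, hence the triangle identities hold almost by computation. The content lies in
  the monotonicity of the unit and in the strict equality of cone after rel with the identity on
  objects.\<close>

text \<open>Antisymmetry, tested at \<open>x\<close> and \<open>y\<close> themselves. Joins,
  rectangles and lower adjoints are all known through their upper bounds, so most equalities below
  take this route.\<close>

lemma (in partial_order) eq_if_same_upper_bounds:
  assumes "x \<in> carrier L" "y \<in> carrier L" "\<And>z. z \<in> carrier L \<Longrightarrow> x \<sqsubseteq> z \<longleftrightarrow> y \<sqsubseteq> z"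
  shows "x = y"
  using assms by (meson le_antisym le_refl)

text \<open>The infimum of \<open>A\<close> is the supremum of its lower bounds. A quotient by a
  frame congruence has evident suprema but no evident infima.\<close>

lemma (in partial_order) complete_lattice_if_sups:
  assumes sups: "\<And>A. A \<subseteq> carrier L \<Longrightarrow> \<exists>s. is_lub L s A"
  shows "complete_lattice L"
proof (rule complete_latticeI)
  fix A assume A: "A \<subseteq> carrier L"
  obtain s where s: "is_lub L s (Lower L A)"
    using sups[of "Lower L A"] by auto
  have "is_glb L s A"
  proof (rule greatest_LowerI)
    fix x assume "x \<in> A"
    then have "x \<in> Upper L (Lower L A)"
      using A by (auto intro!: Upper_memI)
    then show "s \<sqsubseteq> x"
      using s by (rule least_le[rotated])
  qed (use A s in \<open>auto intro: least_Upper_above\<close>)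
  then show "\<exists>i. is_glb L i A" ..
qed (rule sups)

context complete_lattice
begin

lemma sup_le_iff:
  assumes "A \<subseteq> carrier L" "z \<in> carrier L"
  shows "\<Squnion>A \<sqsubseteq> z \<longleftrightarrow> (\<forall>x\<in>A. x \<sqsubseteq> z)"
  using assms by (meson le_trans subsetD sup_closed sup_least sup_upper)

lemma le_meet_iff:
  assumes "x \<in> carrier L" "y \<in> carrier L" "z \<in> carrier L"
  shows "z \<sqsubseteq> x \<sqinter> y \<longleftrightarrow> z \<sqsubseteq> x \<and> z \<sqsubseteq> y"
  using assms by (meson le_trans meet_closed meet_le meet_left meet_right)

lemma meet_absorb:
  assumes "x \<in> carrier L" "y \<in> carrier L" "x \<sqsubseteq> y"
  shows "x \<sqinter> y = x"
  using assms le_iff_join by metis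

lemma sup_eqI:
  assumes "A \<subseteq> carrier L" "s \<in> carrier L" "\<And>x. x \<in> A \<Longrightarrow> x \<sqsubseteq> s"
    and "\<And>z. \<lbrakk>z \<in> carrier L; \<And>x. x \<in> A \<Longrightarrow> x \<sqsubseteq> z\<rbrakk> \<Longrightarrow> s \<sqsubseteq> z"
  shows "\<Squnion>A = s"
  using assms by (intro eq_if_same_upper_bounds) (auto simp: sup_le_iff intro: le_trans[of _ s])

lemma meet_eqI:
  assumes "x \<in> carrier L" "y \<in> carrier L" "m \<in> carrier L" "m \<sqsubseteq> x" "m \<sqsubseteq> y"
    and "\<And>z. \<lbrakk>z \<in> carrier L; z \<sqsubseteq> x; z \<sqsubseteq> y\<rbrakk> \<Longrightarrow> z \<sqsubseteq> m"
  shows "x \<sqinter> y = m"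
  using assms by (meson le_antisym meet_closed meet_le meet_left meet_right)

lemma top_eqI:
  assumes "t \<in> carrier L" "\<And>x. x \<in> carrier L \<Longrightarrow> x \<sqsubseteq> t"
  shows "\<top> = t"
  using assms by (intro le_antisym) auto

lemma meet_mono:
  assumes "a \<in> carrier L" "b \<in> carrier L" "c \<in> carrier L" "d \<in> carrier L" "a \<sqsubseteq> c" "b \<sqsubseteq> d"
  shows "a \<sqinter> b \<sqsubseteq> c \<sqinter> d"
  using assms by (meson le_trans meet_closed meet_le meet_left meet_right)

end

lemma frame_homsD:
  assumes "h \<in> frame_homs L M"
  shows "h \<in> carrier L \<rightarrow>\<^sub>E carrier M" "\<And>x. x \<in> carrier L \<Longrightarrow> h x \<in> carrier M"
    and "complete_lattice L" "complete_lattice M"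
    and "\<And>A. A \<subseteq> carrier L \<Longrightarrow> h (\<Squnion>\<^bsub>L\<^esub>A) = \<Squnion>\<^bsub>M\<^esub>(h ` A)"
    and "\<And>x y. \<lbrakk>x \<in> carrier L; y \<in> carrier L\<rbrakk> \<Longrightarrow> h (x \<sqinter>\<^bsub>L\<^esub> y) = h x \<sqinter>\<^bsub>M\<^esub> h y"
    and "h \<top>\<^bsub>L\<^esub> = \<top>\<^bsub>M\<^esub>"
  using assms by (auto simp: frame_homs_def sup_pres_def meet_pres_def)

lemma frame_homsI:
  assumes "complete_lattice L" "complete_lattice M" "h \<in> carrier L \<rightarrow>\<^sub>E carrier M"
    and "\<And>A. A \<subseteq> carrier L \<Longrightarrow> h (\<Squnion>\<^bsub>L\<^esub>A) = \<Squnion>\<^bsub>M\<^esub>(h ` A)"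
    and "\<And>x y. \<lbrakk>x \<in> carrier L; y \<in> carrier L\<rbrakk> \<Longrightarrow> h (x \<sqinter>\<^bsub>L\<^esub> y) = h x \<sqinter>\<^bsub>M\<^esub> h y"
    and "h \<top>\<^bsub>L\<^esub> = \<top>\<^bsub>M\<^esub>"
  shows "h \<in> frame_homs L M"
  using assms by (auto simp: frame_homs_def sup_pres_def meet_pres_def)

lemma frame_homs_mono:
  assumes h: "h \<in> frame_homs L M" and xy: "x \<in> carrier L" "y \<in> carrier L" "x \<sqsubseteq>\<^bsub>L\<^esub> y"
  shows "h x \<sqsubseteq>\<^bsub>M\<^esub> h y"
proof -
  have "isotone L M h"
    using h by (intro meet_pres_isotone) (auto simp: frame_homs_def)
  then show ?thesis
    using xy by (simp add: use_iso2)
qed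

lemma id_frame_homs:
  assumes "complete_lattice L"
  shows "(\<lambda>x\<in>carrier L. x) \<in> frame_homs L L"
proof -
  interpret complete_lattice L by fact
  show ?thesis
    by (rule frame_homsI) (auto simp: assms subset_iff)
qed

lemma compose_frame_homs:
  assumes f: "f \<in> frame_homs M N" and g: "g \<in> frame_homs L M"
  shows "compose (carrier L) f g \<in> frame_homs L N"
proof -
  interpret L: complete_lattice L by (rule frame_homsD(3)[OF g])
  show ?thesis
  proof (rule frame_homsI)
    fix A assume A: "A \<subseteq> carrier L"
    then have "g ` A \<subseteq> carrier M"
      using frame_homsD(2)[OF g] by auto
    then show "compose (carrier L) f g (\<Squnion>\<^bsub>L\<^esub>A) = \<Squnion>\<^bsub>N\<^esub>(compose (carrier L) f g ` A)"
      using A by (simp add: compose_def frame_homsD(5)[OF f] frame_homsD(5)[OF g] image_image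
          subset_iff cong: image_cong_simp)
  qed (use frame_homsD[OF f] frame_homsD[OF g] in \<open>auto simp: compose_def\<close>)
qed

section \<open>Quotients by frame congruences\<close>

locale lattice_congruence = complete_lattice L for L (structure) +
  fixes \<theta> :: "('a \<times> 'a) set"
  assumes congruence: "frame_congruence L \<theta>"
begin

abbreviation Q where "Q \<equiv> quot_frame L \<theta>"
abbreviation q where "q \<equiv> quot_map L \<theta>"

lemma equiv: "equiv (carrier L) \<theta>"
  using congruence by (simp add: frame_congruence_def)

lemma cong_carrier: "(a, b) \<in> \<theta> \<Longrightarrow> a \<in> carrier L" "(a, b) \<in> \<theta> \<Longrightarrow> b \<in> carrier L"
  using equiv by (auto simp: equiv_def refl_on_def)

lemma cong_refl: "a \<in> carrier L \<Longrightarrow> (a, a) \<in> \<theta>"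
  using equiv by (auto simp: equiv_def refl_on_def)

lemma cong_sym: "(a, b) \<in> \<theta> \<Longrightarrow> (b, a) \<in> \<theta>"
  using equiv by (auto simp: equiv_def sym_def)

lemma cong_trans: "(a, b) \<in> \<theta> \<Longrightarrow> (b, c) \<in> \<theta> \<Longrightarrow> (a, c) \<in> \<theta>"
  using equiv by (auto simp: equiv_def elim: transE)

lemma cong_meet: "(a, b) \<in> \<theta> \<Longrightarrow> (c, d) \<in> \<theta> \<Longrightarrow> (a \<sqinter> c, b \<sqinter> d) \<in> \<theta>"
  using congruence unfolding frame_congruence_def by blast

lemma cong_sup: "S \<subseteq> \<theta> \<Longrightarrow> (\<Squnion>(fst ` S), \<Squnion>(snd ` S)) \<in> \<theta>"
  using congruence by (simp add: frame_congruence_def)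

lemma cong_sup_image:
  assumes "\<And>a. a \<in> A \<Longrightarrow> (a, f a) \<in> \<theta>"
  shows "(\<Squnion>A, \<Squnion>(f ` A)) \<in> \<theta>"
  using cong_sup[of "(\<lambda>a. (a, f a)) ` A"] assms by (auto simp: image_image)

text \<open>Meeting the pair \<open>(a, c)\<close> with \<open>b\<close> gives
  \<open>(a, b)\<close>, because \<open>a \<sqinter> b = a\<close> and
  \<open>c \<sqinter> b = b\<close>. It serves where an inequality squeezes a rectangle between two
  identified ones.\<close>

lemma cong_convex:
  assumes "(a, c) \<in> \<theta>" "b \<in> carrier L" "a \<sqsubseteq> b" "b \<sqsubseteq> c"
  shows "(a, b) \<in> \<theta>"
  using cong_meet[OF assms(1) cong_refl[OF assms(2)]] assms cong_carrier[OF assms(1)]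
  by (simp add: meet_absorb meet_comm[of _ c b])

lemma carrier_quotient: "carrier Q = q ` carrier L"
  by (auto simp: quot_frame_def quot_map_def quotient_def)

lemma q_closed: "a \<in> carrier L \<Longrightarrow> q a \<in> carrier Q"
  by (simp add: carrier_quotient)

lemma q_eq_iff:
  assumes "a \<in> carrier L" "b \<in> carrier L"
  shows "q a = q b \<longleftrightarrow> (a, b) \<in> \<theta>"
  using eq_equiv_class_iff[OF equiv] assms by (simp add: quot_map_def)

text \<open>Comparable representatives \<open>a'\<close> and \<open>b'\<close> make
  \<open>a \<sqinter> b\<close> congruent to \<open>a' \<sqinter> b' = a'\<close>, hence to
  \<open>a\<close>. This trades the existential order of the quotient for one identification between
  fixed elements.\<close>

lemma q_le_iff:
  assumes "a \<in> carrier L" "b \<in> carrier L"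
  shows "q a \<sqsubseteq>\<^bsub>Q\<^esub> q b \<longleftrightarrow> (a, a \<sqinter> b) \<in> \<theta>"
proof
  assume "q a \<sqsubseteq>\<^bsub>Q\<^esub> q b"
  then obtain a' b' where ab: "(a, a') \<in> \<theta>" "(b, b') \<in> \<theta>" "a' \<sqsubseteq> b'"
    using assms by (auto simp: quot_frame_def quot_map_def)
  then have "(a \<sqinter> b, a') \<in> \<theta>"
    using cong_meet[OF ab(1,2)] cong_carrier[OF ab(1)] cong_carrier[OF ab(2)] by (simp add: meet_absorb)
  then show "(a, a \<sqinter> b) \<in> \<theta>"
    using ab(1) cong_sym cong_trans by blast
next
  assume "(a, a \<sqinter> b) \<in> \<theta>"
  moreover have "(b, b) \<in> \<theta>"
    using assms by (simp add: cong_refl)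
  ultimately show "q a \<sqsubseteq>\<^bsub>Q\<^esub> q b"
    using assms meet_right[of a b] by (auto simp: quot_frame_def quot_map_def)
qed

lemma q_mono:
  assumes "a \<in> carrier L" "b \<in> carrier L" "a \<sqsubseteq> b"
  shows "q a \<sqsubseteq>\<^bsub>Q\<^esub> q b"
  using assms by (simp add: q_le_iff meet_absorb cong_refl)

lemma partial_order_quotient: "partial_order Q"
proof
  have eq: "eq Q = (=)"
    by (simp add: quot_frame_def)
  then show "(.=\<^bsub>Q\<^esub>) = (=)" .
  fix x y z w
  show "x .=\<^bsub>Q\<^esub> x" by (simp add: eq)
  show "x .=\<^bsub>Q\<^esub> y \<Longrightarrow> y .=\<^bsub>Q\<^esub> x" by (simp add: eq)
  show "x .=\<^bsub>Q\<^esub> y \<Longrightarrow> y .=\<^bsub>Q\<^esub> z \<Longrightarrow> x .=\<^bsub>Q\<^esub> z" by (simp add: eq)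
  show "x .=\<^bsub>Q\<^esub> y \<Longrightarrow> z .=\<^bsub>Q\<^esub> w \<Longrightarrow> (x \<sqsubseteq>\<^bsub>Q\<^esub> z) = (y \<sqsubseteq>\<^bsub>Q\<^esub> w)" by (simp add: eq)
  assume "x \<in> carrier Q"
  then obtain a where a: "x = q a" "a \<in> carrier L"
    by (auto simp: carrier_quotient)
  then show "x \<sqsubseteq>\<^bsub>Q\<^esub> x"
    by (simp add: q_mono)
  assume "y \<in> carrier Q"
  then obtain b where b: "y = q b" "b \<in> carrier L"
    by (auto simp: carrier_quotient)
  show "x .=\<^bsub>Q\<^esub> y" if "x \<sqsubseteq>\<^bsub>Q\<^esub> y" "y \<sqsubseteq>\<^bsub>Q\<^esub> x"
  proof -
    have "(a, a \<sqinter> b) \<in> \<theta>" "(b, a \<sqinter> b) \<in> \<theta>"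
      using that a b by (auto simp: q_le_iff meet_comm[of _ a])
    then have "(a, b) \<in> \<theta>"
      using cong_sym cong_trans by blast
    then show ?thesis
      using a b by (simp add: eq q_eq_iff)
  qed
  assume "z \<in> carrier Q"
  then obtain c where c: "z = q c" "c \<in> carrier L"
    by (auto simp: carrier_quotient)
  show "x \<sqsubseteq>\<^bsub>Q\<^esub> z" if "x \<sqsubseteq>\<^bsub>Q\<^esub> y" "y \<sqsubseteq>\<^bsub>Q\<^esub> z"
  proof -
    have ab: "(a, a \<sqinter> b) \<in> \<theta>" and bc: "(b, b \<sqinter> c) \<in> \<theta>"
      using that a b c by (auto simp: q_le_iff)
    \<comment> \<open>Both \<open>a \<sqinter> b\<close> and \<open>a \<sqinter> c\<close> are
      congruent to the triple meet, and \<open>a\<close> is congruent to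
      \<open>a \<sqinter> b\<close>.\<close>
    have "(a \<sqinter> b, a \<sqinter> (b \<sqinter> c)) \<in> \<theta>"
      using cong_meet[OF cong_refl bc] a by simp
    moreover have "(a \<sqinter> c, a \<sqinter> (b \<sqinter> c)) \<in> \<theta>"
      using cong_meet[OF ab cong_refl, of c] a b c by (simp add: meet_assoc)
    ultimately have "(a, a \<sqinter> c) \<in> \<theta>"
      using ab cong_sym cong_trans by blast
    then show ?thesis
      using a c by (simp add: q_le_iff)
  qed
qed

text \<open>An upper bound \<open>q b\<close> makes every \<open>a\<close> in \<open>A\<close>
  congruent to \<open>a \<sqinter> b\<close>. Congruences are closed under joins, so
  \<open>\<Squnion>A\<close> is congruent to a join of elements below \<open>b\<close>.\<close>

lemma lub_q_image:
  assumes A: "A \<subseteq> carrier L"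
  shows "is_lub Q (q (\<Squnion>A)) (q ` A)"
proof (rule least_UpperI)
  fix x assume "x \<in> q ` A"
  then show "x \<sqsubseteq>\<^bsub>Q\<^esub> q (\<Squnion>A)"
    using A by (auto intro!: q_mono sup_upper)
next
  fix y assume y: "y \<in> Upper Q (q ` A)"
  then obtain b where b: "y = q b" "b \<in> carrier L"
    by (auto simp: Upper_def carrier_quotient)
  have "(a, a \<sqinter> b) \<in> \<theta>" if "a \<in> A" for a
    using y A b that by (subst q_le_iff[symmetric]) (auto simp: Upper_def q_closed)
  then have "(\<Squnion>A, \<Squnion>((\<lambda>a. a \<sqinter> b) ` A)) \<in> \<theta>"
    by (rule cong_sup_image)
  moreover have sub: "(\<lambda>a. a \<sqinter> b) ` A \<subseteq> carrier L"
    using A b by auto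
  ultimately have "q (\<Squnion>A) = q (\<Squnion>((\<lambda>a. a \<sqinter> b) ` A))"
    using A by (simp add: q_eq_iff)
  also have "\<dots> \<sqsubseteq>\<^bsub>Q\<^esub> q b"
    using sub A b by (intro q_mono sup_least) (auto intro: meet_right)
  finally show "q (\<Squnion>A) \<sqsubseteq>\<^bsub>Q\<^esub> y"
    by (simp add: b)
qed (use A in \<open>auto simp: q_closed\<close>)

lemma complete_lattice_quotient: "complete_lattice Q"
proof (rule partial_order.complete_lattice_if_sups[OF partial_order_quotient])
  fix \<A> assume "\<A> \<subseteq> carrier Q"
  then obtain A where A: "A \<subseteq> carrier L" "\<A> = q ` A"
    unfolding carrier_quotient by (rule subset_imageE)
  show "\<exists>s. is_lub Q s \<A>"
    unfolding A(2) using lub_q_image[OF A(1)] by (rule exI)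
qed

lemma q_frame_homs: "q \<in> frame_homs L Q"
proof -
  interpret Q: complete_lattice Q
    by (rule complete_lattice_quotient)
  show ?thesis
  proof (rule frame_homsI)
    show "q \<in> carrier L \<rightarrow>\<^sub>E carrier Q"
      using q_closed by (auto simp: quot_map_def)
    show "q (\<Squnion>A) = \<Squnion>\<^bsub>Q\<^esub>(q ` A)" if "A \<subseteq> carrier L" for A
      by (rule Q.least_unique[OF lub_q_image[OF that] Q.sup_lub]) (use that q_closed in auto)
    show "q (x \<sqinter> y) = q x \<sqinter>\<^bsub>Q\<^esub> q y" if xy: "x \<in> carrier L" "y \<in> carrier L" for x y
    proof (rule Q.meet_eqI[symmetric])
      fix Z assume Z: "Z \<in> carrier Q" "Z \<sqsubseteq>\<^bsub>Q\<^esub> q x" "Z \<sqsubseteq>\<^bsub>Q\<^esub> q y"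
      then obtain z where z: "Z = q z" "z \<in> carrier L"
        by (auto simp: carrier_quotient)
      then have zx: "(z, z \<sqinter> x) \<in> \<theta>" and zy: "(z, z \<sqinter> y) \<in> \<theta>"
        using Z xy by (auto simp: q_le_iff)
      have "(z \<sqinter> y, z \<sqinter> (x \<sqinter> y)) \<in> \<theta>"
        using cong_meet[OF zx cong_refl, of y] xy z by (simp add: meet_assoc)
      then show "Z \<sqsubseteq>\<^bsub>Q\<^esub> q (x \<sqinter> y)"
        using cong_trans[OF zy] xy z by (simp add: q_le_iff)
    qed (use xy in \<open>auto intro!: q_closed q_mono meet_left meet_right\<close>)
    show "q \<top> = \<top>\<^bsub>Q\<^esub>"
      by (rule Q.top_eqI[symmetric]) (auto simp: carrier_quotient intro: q_mono)
  qed (rule complete_lattice_axioms complete_lattice_quotient)+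
qed

text \<open>The universal property of the sublocale. It eliminates the existential restriction map
  from \<open>monotone_map\<close>.\<close>

lemma factor_through_q:
  assumes k: "k \<in> frame_homs L N" and resp: "\<And>u v. (u, v) \<in> \<theta> \<Longrightarrow> k u = k v"
  shows "\<exists>g\<in>frame_homs Q N. \<forall>u\<in>carrier L. g (q u) = k u"
proof -
  \<comment> \<open>\<open>k\<close> is constant on every class, so the image of a class is a
    singleton and \<open>the_elem\<close> returns its value. Restricting to the carrier makes
    \<open>g\<close> extensional.\<close>
  define g where "g = (\<lambda>A\<in>carrier Q. the_elem (k ` A))"
  have g: "g (q u) = k u" if u: "u \<in> carrier L" for u
  proof -
    have "k v = k u" if "v \<in> q u" for v
      using that u resp[of u v] by (simp add: quot_map_def)
    moreover have "u \<in> q u"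
      using u cong_refl[OF u] by (simp add: quot_map_def)
    ultimately have "k ` q u = {k u}"
      by blast
    then show ?thesis
      by (simp add: g_def q_closed u)
  qed
  interpret Q: complete_lattice Q
    by (rule complete_lattice_quotient)
  have "g \<in> frame_homs Q N"
  proof (rule frame_homsI)
    show "g \<in> carrier Q \<rightarrow>\<^sub>E carrier N"
    proof
      fix A assume "A \<in> carrier Q"
      then obtain u where "A = q u" "u \<in> carrier L"
        unfolding carrier_quotient by (rule imageE)
      then show "g A \<in> carrier N"
        using frame_homsD(2)[OF k] by (simp add: g)
    qed (simp add: g_def)
    show "g (\<Squnion>\<^bsub>Q\<^esub>\<A>) = \<Squnion>\<^bsub>N\<^esub>(g ` \<A>)" if \<A>: "\<A> \<subseteq> carrier Q" for \<A>
    proof -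
      obtain A where A: "A \<subseteq> carrier L" "\<A> = q ` A"
        using \<A> unfolding carrier_quotient by (rule subset_imageE)
      have "g (\<Squnion>\<^bsub>Q\<^esub>\<A>) = k (\<Squnion>A)"
        using A by (simp add: frame_homsD(5)[OF q_frame_homs, symmetric] g)
      also have "\<dots> = \<Squnion>\<^bsub>N\<^esub>(k ` A)"
        by (rule frame_homsD(5)[OF k A(1)])
      also have "k ` A = g ` \<A>"
        unfolding A(2) image_image using A(1) by (intro image_cong) (auto simp: g)
      finally show ?thesis .
    qed
    show "g (x \<sqinter>\<^bsub>Q\<^esub> y) = g x \<sqinter>\<^bsub>N\<^esub> g y" if xy: "x \<in> carrier Q" "y \<in> carrier Q" for x y
    proof -
      obtain u where u: "x = q u" "u \<in> carrier L"
        using xy(1) unfolding carrier_quotient by (rule imageE)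
      obtain v where v: "y = q v" "v \<in> carrier L"
        using xy(2) unfolding carrier_quotient by (rule imageE)
      have "g (x \<sqinter>\<^bsub>Q\<^esub> y) = g (q (u \<sqinter> v))"
        using u v by (simp add: frame_homsD(6)[OF q_frame_homs])
      then show ?thesis
        using u v by (simp add: g frame_homsD(6)[OF k])
    qed
    show "g \<top>\<^bsub>Q\<^esub> = \<top>\<^bsub>N\<^esub>"
      using g[of \<top>] by (simp add: frame_homsD(7)[OF q_frame_homs] frame_homsD(7)[OF k])
  qed (rule complete_lattice_quotient frame_homsD(4)[OF k])+
  then show ?thesis
    using g by (intro bexI[of _ g]) simp_all
qed

end

section \<open>Preimages and generation of frame congruences\<close>

lemma frame_congruenceI:
  assumes "equiv (carrier L) \<theta>"
    and "\<And>a b c d. \<lbrakk>(a, b) \<in> \<theta>; (c, d) \<in> \<theta>\<rbrakk> \<Longrightarrow> (a \<sqinter>\<^bsub>L\<^esub> c, b \<sqinter>\<^bsub>L\<^esub> d) \<in> \<theta>"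
    and "\<And>S. S \<subseteq> \<theta> \<Longrightarrow> (\<Squnion>\<^bsub>L\<^esub>(fst ` S), \<Squnion>\<^bsub>L\<^esub>(snd ` S)) \<in> \<theta>"
  shows "frame_congruence L \<theta>"
  unfolding frame_congruence_def using assms(1,2) by (auto simp: assms(3))

text \<open>Since the pairs that \<open>h\<close> sends into \<open>\<theta>\<close> already form a
  congruence, respecting a generated congruence can be checked on its generators.\<close>

lemma frame_congruence_vimage:
  assumes h: "h \<in> frame_homs L M" and \<theta>: "frame_congruence M \<theta>"
  shows "frame_congruence L {(u, v) \<in> carrier L \<times> carrier L. (h u, h v) \<in> \<theta>}" (is "frame_congruence L ?P")
proof -
  interpret L: complete_lattice L by (rule frame_homsD(3)[OF h])
  interpret lattice_congruence M \<theta>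
    using frame_homsD(4)[OF h] \<theta> by (simp add: lattice_congruence_def lattice_congruence_axioms_def)
  show ?thesis
  proof (rule frame_congruenceI)
    show "equiv (carrier L) ?P"
    proof (intro equivI refl_onI symI transI)
      show "(x, z) \<in> ?P" if "(x, y) \<in> ?P" "(y, z) \<in> ?P" for x y z
        using that cong_trans[of "h x" "h y" "h z"] by auto
      show "(y, x) \<in> ?P" if "(x, y) \<in> ?P" for x y
        using that cong_sym[of "h x" "h y"] by simp
      show "(x, x) \<in> ?P" if "x \<in> carrier L" for x
        using that cong_refl[of "h x"] frame_homsD(2)[OF h] by simp
    qed auto
    show "(a \<sqinter>\<^bsub>L\<^esub> c, b \<sqinter>\<^bsub>L\<^esub> d) \<in> ?P" if "(a, b) \<in> ?P" "(c, d) \<in> ?P" for a b c d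
      using that cong_meet[of "h a" "h b" "h c" "h d"] by (simp add: frame_homsD(6)[OF h])
    fix S assume S: "S \<subseteq> ?P"
    have S': "fst p \<in> carrier L" "snd p \<in> carrier L" "map_prod h h p \<in> \<theta>" if "p \<in> S" for p
      using subsetD[OF S that] by (cases p; simp)+
    then have "map_prod h h ` S \<subseteq> \<theta>"
      by (simp add: image_subset_iff)
    from cong_sup[OF this] have "(\<Squnion>\<^bsub>M\<^esub>(h ` fst ` S), \<Squnion>\<^bsub>M\<^esub>(h ` snd ` S)) \<in> \<theta>"
      by (simp add: image_image)
    moreover have "fst ` S \<subseteq> carrier L" "snd ` S \<subseteq> carrier L"
      using S' by (simp_all add: image_subset_iff)
    ultimately show "(\<Squnion>\<^bsub>L\<^esub>(fst ` S), \<Squnion>\<^bsub>L\<^esub>(snd ` S)) \<in> ?P"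
      by (simp add: frame_homsD(5)[OF h])
  qed
qed

lemma least_frame_congruence_subset:
  "frame_congruence L \<theta> \<Longrightarrow> S \<subseteq> \<theta> \<Longrightarrow> least_frame_congruence L S \<subseteq> \<theta>"
  by (auto simp: least_frame_congruence_def)

lemma subset_least_frame_congruence: "S \<subseteq> least_frame_congruence L S"
  by (auto simp: least_frame_congruence_def)

lemma frame_congruence_least:
  fixes L (structure)
  assumes L: "complete_lattice L" and S: "S \<subseteq> carrier L \<times> carrier L"
  shows "frame_congruence L (least_frame_congruence L S)" (is "frame_congruence L ?T")
proof -
  interpret complete_lattice L by fact
  \<comment> \<open>The full relation contains \<open>S\<close>, so the intersection runs over a
    nonempty family and stays inside the carrier.\<close>
  have full: "frame_congruence L (carrier L \<times> carrier L)"
  proof (rule frame_congruenceI)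
    show "(\<Squnion>(fst ` A), \<Squnion>(snd ` A)) \<in> carrier L \<times> carrier L" if "A \<subseteq> carrier L \<times> carrier L" for A
    proof -
      have "fst ` A \<subseteq> carrier L" "snd ` A \<subseteq> carrier L"
        using that by (auto dest: subsetD)
      then show ?thesis
        by simp
    qed
  qed (auto simp: equiv_def refl_on_def sym_def trans_def)
  have sub: "?T \<subseteq> carrier L \<times> carrier L"
    using full S by (rule least_frame_congruence_subset)
  have cong: "lattice_congruence L \<theta>" if "frame_congruence L \<theta>" for \<theta>
    using that L by (simp add: lattice_congruence_def lattice_congruence_axioms_def)
  have T_iff: "p \<in> ?T \<longleftrightarrow> (\<forall>\<theta>. frame_congruence L \<theta> \<and> S \<subseteq> \<theta> \<longrightarrow> p \<in> \<theta>)" for p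
    by (simp add: least_frame_congruence_def)
  show ?thesis
  proof (rule frame_congruenceI)
    show "equiv (carrier L) ?T"
    proof (intro equivI refl_onI symI transI)
      show "(x, x) \<in> ?T" if "x \<in> carrier L" for x
        using that lattice_congruence.cong_refl[OF cong] by (simp add: T_iff)
      show "(y, x) \<in> ?T" if "(x, y) \<in> ?T" for x y
        using that lattice_congruence.cong_sym[OF cong] by (simp add: T_iff)
      show "(x, z) \<in> ?T" if "(x, y) \<in> ?T" "(y, z) \<in> ?T" for x y z
        using that lattice_congruence.cong_trans[OF cong, of _ x y z] by (simp add: T_iff)
    qed (rule sub)
    show "(a \<sqinter> c, b \<sqinter> d) \<in> ?T" if "(a, b) \<in> ?T" "(c, d) \<in> ?T" for a b c d
      using that lattice_congruence.cong_meet[OF cong, of _ a b c d] by (simp add: T_iff)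
    show "(\<Squnion>(fst ` A), \<Squnion>(snd ` A)) \<in> ?T" if "A \<subseteq> ?T" for A
    proof -
      have "A \<subseteq> \<theta>" if "frame_congruence L \<theta> \<and> S \<subseteq> \<theta>" for \<theta>
        using \<open>A \<subseteq> ?T\<close> that by (auto simp: T_iff)
      then show ?thesis
        using lattice_congruence.cong_sup[OF cong, of _ A] by (simp add: T_iff)
    qed
  qed
qed

section \<open>Coproducts of frames\<close>

lemma (in frame) complete_lattice: "complete_lattice L" ..

lemma (in frame) meet_Sup_distrib':
  assumes "x \<in> carrier L" "A \<subseteq> carrier L"
  shows "\<Squnion>A \<sqinter> x = \<Squnion>((\<lambda>a. a \<sqinter> x) ` A)"
  using meet_Sup_distrib[OF assms] by (simp add: meet_comm[of _ x])

lemma coprod_simps [simp]: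
  "carrier (coprod L M) = {D. coprod_ideal L M D}"
  "D \<sqsubseteq>\<^bsub>coprod L M\<^esub> E \<longleftrightarrow> D \<subseteq> E"
  "eq (coprod L M) = (=)"
  by (simp_all add: coprod_def)

lemma coprod_idealI:
  assumes "D \<subseteq> carrier L \<times> carrier M"
    and "\<And>x y x' y'. \<lbrakk>(x, y) \<in> D; x' \<in> carrier L; y' \<in> carrier M; x' \<sqsubseteq>\<^bsub>L\<^esub> x; y' \<sqsubseteq>\<^bsub>M\<^esub> y\<rbrakk>
      \<Longrightarrow> (x', y') \<in> D"
    and "\<And>A y. \<lbrakk>A \<subseteq> carrier L; y \<in> carrier M; \<And>a. a \<in> A \<Longrightarrow> (a, y) \<in> D\<rbrakk> \<Longrightarrow> (\<Squnion>\<^bsub>L\<^esub>A, y) \<in> D"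
    and "\<And>x B. \<lbrakk>x \<in> carrier L; B \<subseteq> carrier M; \<And>b. b \<in> B \<Longrightarrow> (x, b) \<in> D\<rbrakk> \<Longrightarrow> (x, \<Squnion>\<^bsub>M\<^esub>B) \<in> D"
  shows "coprod_ideal L M D"
  unfolding coprod_ideal_def
proof (intro conjI)
  show "\<forall>(x, y)\<in>D. \<forall>x'\<in>carrier L. \<forall>y'\<in>carrier M. x' \<sqsubseteq>\<^bsub>L\<^esub> x \<and> y' \<sqsubseteq>\<^bsub>M\<^esub> y \<longrightarrow> (x', y') \<in> D"
    using assms(2) by blast
  show "\<forall>A\<subseteq>carrier L. \<forall>y\<in>carrier M. A \<times> {y} \<subseteq> D \<longrightarrow> (\<Squnion>\<^bsub>L\<^esub>A, y) \<in> D"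
    using assms(3) by (simp add: subset_iff)
  show "\<forall>x\<in>carrier L. \<forall>B\<subseteq>carrier M. {x} \<times> B \<subseteq> D \<longrightarrow> (x, \<Squnion>\<^bsub>M\<^esub>B) \<in> D"
    using assms(4) by (simp add: subset_iff)
qed (rule assms(1))

lemma coprod_idealD:
  assumes "coprod_ideal L M D"
  shows "D \<subseteq> carrier L \<times> carrier M"
    and "\<And>x y x' y'. \<lbrakk>(x, y) \<in> D; x' \<in> carrier L; y' \<in> carrier M; x' \<sqsubseteq>\<^bsub>L\<^esub> x; y' \<sqsubseteq>\<^bsub>M\<^esub> y\<rbrakk>
      \<Longrightarrow> (x', y') \<in> D"
    and "\<And>A y. \<lbrakk>A \<subseteq> carrier L; y \<in> carrier M; \<And>a. a \<in> A \<Longrightarrow> (a, y) \<in> D\<rbrakk> \<Longrightarrow> (\<Squnion>\<^bsub>L\<^esub>A, y) \<in> D"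
    and "\<And>x B. \<lbrakk>x \<in> carrier L; B \<subseteq> carrier M; \<And>b. b \<in> B \<Longrightarrow> (x, b) \<in> D\<rbrakk> \<Longrightarrow> (x, \<Squnion>\<^bsub>M\<^esub>B) \<in> D"
proof -
  show "D \<subseteq> carrier L \<times> carrier M"
    using assms by (simp add: coprod_ideal_def)
  show "(x', y') \<in> D" if "(x, y) \<in> D" "x' \<in> carrier L" "y' \<in> carrier M" "x' \<sqsubseteq>\<^bsub>L\<^esub> x" "y' \<sqsubseteq>\<^bsub>M\<^esub> y"
    for x y x' y'
    using that bspec[OF conjunct1[OF conjunct2[OF assms[unfolded coprod_ideal_def]]] that(1)] by simp
  show "(\<Squnion>\<^bsub>L\<^esub>A, y) \<in> D" if "A \<subseteq> carrier L" "y \<in> carrier M" "\<And>a. a \<in> A \<Longrightarrow> (a, y) \<in> D" for A y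
  proof -
    have "A \<times> {y} \<subseteq> D"
      using that by auto
    then show ?thesis
      using assms that by (simp add: coprod_ideal_def)
  qed
  show "(x, \<Squnion>\<^bsub>M\<^esub>B) \<in> D" if "x \<in> carrier L" "B \<subseteq> carrier M" "\<And>b. b \<in> B \<Longrightarrow> (x, b) \<in> D" for x B
  proof -
    have "{x} \<times> B \<subseteq> D"
      using that by auto
    then show ?thesis
      using assms that by (simp add: coprod_ideal_def)
  qed
qed

lemma coprod_ideal_Inter:
  assumes "\<D> \<noteq> {}" "\<And>D. D \<in> \<D> \<Longrightarrow> coprod_ideal L M D"
  shows "coprod_ideal L M (\<Inter>\<D>)"
proof (rule coprod_idealI)
  show "\<Inter>\<D> \<subseteq> carrier L \<times> carrier M"
    using assms coprod_idealD(1) by blast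
next
  fix A y assume "A \<subseteq> carrier L" "y \<in> carrier M" "\<And>a. a \<in> A \<Longrightarrow> (a, y) \<in> \<Inter>\<D>"
  then show "(\<Squnion>\<^bsub>L\<^esub>A, y) \<in> \<Inter>\<D>"
    using coprod_idealD(3)[OF assms(2)] by blast
next
  fix x B assume "x \<in> carrier L" "B \<subseteq> carrier M" "\<And>b. b \<in> B \<Longrightarrow> (x, b) \<in> \<Inter>\<D>"
  then show "(x, \<Squnion>\<^bsub>M\<^esub>B) \<in> \<Inter>\<D>"
    using coprod_idealD(4)[OF assms(2)] by blast
next
  fix x y x' y' assume "(x, y) \<in> \<Inter>\<D>" "x' \<in> carrier L" "y' \<in> carrier M" "x' \<sqsubseteq>\<^bsub>L\<^esub> x" "y' \<sqsubseteq>\<^bsub>M\<^esub> y"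
  then show "(x', y') \<in> \<Inter>\<D>"
    using coprod_idealD(2)[OF assms(2)] by blast
qed

lemma partial_order_coprod: "partial_order (coprod L M)"
  by unfold_locales auto

section \<open>Opens of a product: the lattice of ideals and its rectangles\<close>

locale frame_pair = L: frame L + M: frame M
  for L :: "'a gorder" and M :: "'b gorder"
begin

abbreviation C where "C \<equiv> coprod L M"
abbreviation rectangle (infixl \<open>\<otimes>\<close> 75) where "x \<otimes> y \<equiv> rect L M x y"

lemma ideal_full: "coprod_ideal L M (carrier L \<times> carrier M)"
  by (rule coprod_idealI) auto

lemma complete_lattice_coprod: "complete_lattice C"
proof (rule partial_order.complete_lattice_criterion1[OF partial_order_coprod])
  show "\<exists>g. greatest C g (carrier C)"
    using ideal_full
    by (intro exI[of _ "carrier L \<times> carrier M"]) (auto simp: greatest_def dest: coprod_idealD(1))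
next
  fix \<A> assume "\<A> \<subseteq> carrier C" "\<A> \<noteq> {}"
  then have "is_glb C (\<Inter>\<A>) \<A>"
    by (intro greatest_LowerI) (auto simp: Lower_def intro: coprod_ideal_Inter)
  then show "\<exists>i. is_glb C i \<A>" ..
qed

sublocale C: complete_lattice C
  by (rule complete_lattice_coprod)

lemma top_coprod: "\<top>\<^bsub>C\<^esub> = carrier L \<times> carrier M"
  by (rule C.top_eqI) (use ideal_full in \<open>auto dest: coprod_idealD(1)\<close>)

lemma meet_coprod:
  assumes "coprod_ideal L M D" "coprod_ideal L M E"
  shows "D \<sqinter>\<^bsub>C\<^esub> E = D \<inter> E"
  using assms coprod_ideal_Inter[of "{D, E}" L M] by (intro C.meet_eqI) auto

lemma sup_coprod_le_iff:
  assumes "\<D> \<subseteq> carrier C" "coprod_ideal L M E"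
  shows "\<Squnion>\<^bsub>C\<^esub>\<D> \<subseteq> E \<longleftrightarrow> (\<forall>D\<in>\<D>. D \<subseteq> E)"
  using C.sup_le_iff[of \<D> E] assms by simp

lemma ideal_sup_coprod: "\<D> \<subseteq> carrier C \<Longrightarrow> coprod_ideal L M (\<Squnion>\<^bsub>C\<^esub>\<D>)"
  using C.sup_closed[of \<D>] by simp

lemma ideal_Int: "coprod_ideal L M D \<Longrightarrow> coprod_ideal L M E \<Longrightarrow> coprod_ideal L M (D \<inter> E)"
  using coprod_ideal_Inter[of "{D, E}" L M] by auto

text \<open>The empty joins in \<open>coprod_ideal\<close> put every pair with a bottom coordinate
  into every ideal; hence the degenerate pairs in \<open>rect_eq\<close>.\<close>

lemma ideal_bottom:
  assumes "coprod_ideal L M D"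
  shows "x \<in> carrier L \<Longrightarrow> (x, \<bottom>\<^bsub>M\<^esub>) \<in> D" "y \<in> carrier M \<Longrightarrow> (\<bottom>\<^bsub>L\<^esub>, y) \<in> D"
  using coprod_idealD(4)[OF assms, of x "{}"] coprod_idealD(3)[OF assms, of "{}" y]
    L.weak_sup_empty M.weak_sup_empty by (auto simp: L.eq_is_equal M.eq_is_equal)

text \<open>The Heyting implication of ideals, which yields the distributive law of the coproduct.\<close>

lemma ideal_imp:
  assumes D: "D \<subseteq> carrier L \<times> carrier M" and E: "coprod_ideal L M E"
  shows "coprod_ideal L M
    {(x, y) \<in> carrier L \<times> carrier M. \<forall>(a, b)\<in>D. (x \<sqinter>\<^bsub>L\<^esub> a, y \<sqinter>\<^bsub>M\<^esub> b) \<in> E}"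
    (is "coprod_ideal L M ?I")
proof (rule coprod_idealI)
  show "?I \<subseteq> carrier L \<times> carrier M"
    by auto
next
  fix x y x' y'
  assume xy: "(x, y) \<in> ?I" and x': "x' \<in> carrier L" "x' \<sqsubseteq>\<^bsub>L\<^esub> x" and y': "y' \<in> carrier M" "y' \<sqsubseteq>\<^bsub>M\<^esub> y"
  have "(x' \<sqinter>\<^bsub>L\<^esub> a, y' \<sqinter>\<^bsub>M\<^esub> b) \<in> E" if "(a, b) \<in> D" for a b
  proof (rule coprod_idealD(2)[OF E])
    show "(x \<sqinter>\<^bsub>L\<^esub> a, y \<sqinter>\<^bsub>M\<^esub> b) \<in> E"
      using xy that by auto
  qed (use that D xy x' y' in \<open>auto intro!: L.meet_mono M.meet_mono\<close>)
  then show "(x', y') \<in> ?I"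
    using x' y' by auto
next
  fix A y assume A: "A \<subseteq> carrier L" and y: "y \<in> carrier M" and I: "\<And>a. a \<in> A \<Longrightarrow> (a, y) \<in> ?I"
  have "(\<Squnion>\<^bsub>L\<^esub>A \<sqinter>\<^bsub>L\<^esub> a, y \<sqinter>\<^bsub>M\<^esub> b) \<in> E" if "(a, b) \<in> D" for a b
  proof -
    have ab: "a \<in> carrier L" "b \<in> carrier M"
      using that D by auto
    \<comment> \<open>By distributivity of \<open>L\<close> the meet with \<open>a\<close> moves
      inside the join, where closure of \<open>E\<close> under joins applies.\<close>
    then have "(\<Squnion>\<^bsub>L\<^esub>((\<lambda>x. x \<sqinter>\<^bsub>L\<^esub> a) ` A), y \<sqinter>\<^bsub>M\<^esub> b) \<in> E"
      using A y I that by (intro coprod_idealD(3)[OF E]) fastforce+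
    then show ?thesis
      using A ab by (simp add: L.meet_Sup_distrib')
  qed
  then show "(\<Squnion>\<^bsub>L\<^esub>A, y) \<in> ?I"
    using A y by auto
next
  fix x B assume x: "x \<in> carrier L" and B: "B \<subseteq> carrier M" and I: "\<And>b. b \<in> B \<Longrightarrow> (x, b) \<in> ?I"
  have "(x \<sqinter>\<^bsub>L\<^esub> a, \<Squnion>\<^bsub>M\<^esub>B \<sqinter>\<^bsub>M\<^esub> b) \<in> E" if "(a, b) \<in> D" for a b
  proof -
    have ab: "a \<in> carrier L" "b \<in> carrier M"
      using that D by auto
    then have "(x \<sqinter>\<^bsub>L\<^esub> a, \<Squnion>\<^bsub>M\<^esub>((\<lambda>y. y \<sqinter>\<^bsub>M\<^esub> b) ` B)) \<in> E"
      using B x I that by (intro coprod_idealD(4)[OF E]) fastforce+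
    then show ?thesis
      using B ab by (simp add: M.meet_Sup_distrib')
  qed
  then show "(x, \<Squnion>\<^bsub>M\<^esub>B) \<in> ?I"
    using x B by auto
qed

text \<open>The distributive law comes from the adjunction between meeting with \<open>D\<close> and
  the implication \<open>?I\<close> into \<open>?E\<close>: every member of the family lies in the
  ideal \<open>?I\<close>, so their join does too.\<close>

lemma frame_coprod: "frame C"
proof
  fix D \<A> assume D: "D \<in> carrier C" and \<A>: "\<A> \<subseteq> carrier C"
  let ?E = "\<Squnion>\<^bsub>C\<^esub>((\<lambda>A. D \<inter> A) ` \<A>)"
  let ?I = "{(x, y) \<in> carrier L \<times> carrier M. \<forall>(a, b)\<in>D. (x \<sqinter>\<^bsub>L\<^esub> a, y \<sqinter>\<^bsub>M\<^esub> b) \<in> ?E}"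
  have DA: "(\<lambda>A. D \<inter> A) ` \<A> \<subseteq> carrier C"
    using D \<A> by (auto intro: ideal_Int)
  have E: "coprod_ideal L M ?E"
    using DA by (rule ideal_sup_coprod)
  have D_sub: "D \<subseteq> carrier L \<times> carrier M"
    using D coprod_idealD(1) by simp
  have upper: "D \<inter> A \<subseteq> ?E" if "A \<in> \<A>" for A
    using C.sup_upper[OF DA, of "D \<inter> A"] that by simp
  have "A \<subseteq> ?I" if A: "A \<in> \<A>" for A
  proof -
    have ideals: "coprod_ideal L M A" "coprod_ideal L M D"
      using A \<A> D by auto
    have "(x \<sqinter>\<^bsub>L\<^esub> a, y \<sqinter>\<^bsub>M\<^esub> b) \<in> D \<inter> A" if xy: "(x, y) \<in> A" and ab: "(a, b) \<in> D" for x y a b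
    proof -
      have "x \<in> carrier L" "y \<in> carrier M" "a \<in> carrier L" "b \<in> carrier M"
        using xy ab D_sub coprod_idealD(1)[OF ideals(1)] by auto
      then show ?thesis
        using coprod_idealD(2)[OF ideals(1) xy] coprod_idealD(2)[OF ideals(2) ab]
        by (simp add: L.meet_left L.meet_right M.meet_left M.meet_right)
    qed
    then show ?thesis
      using upper[OF A] coprod_idealD(1)[OF ideals(1)] by blast
  qed
  then have "\<Squnion>\<^bsub>C\<^esub>\<A> \<subseteq> ?I"
    using \<A> ideal_imp[OF D_sub E] by (subst sup_coprod_le_iff) auto
  \<comment> \<open>A pair lying in \<open>D\<close> and in \<open>?I\<close> is met with itself,
    and idempotence puts it into \<open>?E\<close>.\<close>
  then have "D \<inter> \<Squnion>\<^bsub>C\<^esub>\<A> \<subseteq> ?E"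
    using D_sub by (fastforce simp: L.meet_absorb M.meet_absorb)
  moreover have "?E \<subseteq> D \<inter> \<Squnion>\<^bsub>C\<^esub>\<A>"
    using DA D ideal_sup_coprod[OF \<A>] C.sup_upper[OF \<A>]
    by (subst sup_coprod_le_iff) (auto intro: ideal_Int)
  moreover have "(\<lambda>A. D \<sqinter>\<^bsub>C\<^esub> A) ` \<A> = (\<lambda>A. D \<inter> A) ` \<A>"
    using D \<A> by (intro image_cong) (auto simp: meet_coprod)
  ultimately show "D \<sqinter>\<^bsub>C\<^esub> \<Squnion>\<^bsub>C\<^esub>\<A> = \<Squnion>\<^bsub>C\<^esub>((\<lambda>A. D \<sqinter>\<^bsub>C\<^esub> A) ` \<A>)"
    using D ideal_sup_coprod[OF \<A>] by (simp add: meet_coprod subset_antisym del: le_inf_iff)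
qed

sublocale C: frame C
  by (rule frame_coprod)

text \<open>The rectangle is the least ideal containing its corner, so an inclusion of a rectangle
  becomes membership of one pair.\<close>

lemma rect_le_iff:
  assumes "coprod_ideal L M D"
  shows "x \<otimes> y \<subseteq> D \<longleftrightarrow> (x, y) \<in> D"
  using assms by (auto simp: rect_def)

text \<open>Adding the degenerate pairs to the pairs below the corner already yields an ideal. The
  explicit form is what makes intersections of rectangles computable.\<close>

lemma rect_eq:
  assumes x: "x \<in> carrier L" and y: "y \<in> carrier M"
  shows "x \<otimes> y = {(a, b) \<in> carrier L \<times> carrier M.
    a \<sqsubseteq>\<^bsub>L\<^esub> x \<and> b \<sqsubseteq>\<^bsub>M\<^esub> y \<or> a = \<bottom>\<^bsub>L\<^esub> \<or> b = \<bottom>\<^bsub>M\<^esub>}" (is "_ = ?R")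
proof
  have bot_L: "\<Squnion>\<^bsub>L\<^esub>A = \<bottom>\<^bsub>L\<^esub>" if "A \<subseteq> {\<bottom>\<^bsub>L\<^esub>}" for A
    using that L.weak_sup_empty by (auto simp: subset_singleton_iff L.eq_is_equal)
  have bot_M: "\<Squnion>\<^bsub>M\<^esub>A = \<bottom>\<^bsub>M\<^esub>" if "A \<subseteq> {\<bottom>\<^bsub>M\<^esub>}" for A
    using that M.weak_sup_empty by (auto simp: subset_singleton_iff M.eq_is_equal)
  have "coprod_ideal L M ?R"
  proof (rule coprod_idealI)
    fix a b a' b'
    assume "(a, b) \<in> ?R" "a' \<in> carrier L" "b' \<in> carrier M" "a' \<sqsubseteq>\<^bsub>L\<^esub> a" "b' \<sqsubseteq>\<^bsub>M\<^esub> b"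
    then show "(a', b') \<in> ?R"
      using x y by (auto intro: L.le_trans[of _ a] M.le_trans[of _ b] L.le_antisym M.le_antisym)
  next
    fix A b assume A: "A \<subseteq> carrier L" and b: "b \<in> carrier M" and I: "\<And>a. a \<in> A \<Longrightarrow> (a, b) \<in> ?R"
    show "(\<Squnion>\<^bsub>L\<^esub>A, b) \<in> ?R"
    \<comment> \<open>If \<open>b\<close> is neither below \<open>y\<close> nor bottom, membership
      forces every element of \<open>A\<close> to be bottom.\<close>
    proof (cases "b \<sqsubseteq>\<^bsub>M\<^esub> y \<or> b = \<bottom>\<^bsub>M\<^esub>")
      case True
      have "\<Squnion>\<^bsub>L\<^esub>A \<sqsubseteq>\<^bsub>L\<^esub> x" if "b \<noteq> \<bottom>\<^bsub>M\<^esub>"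
      proof (intro L.sup_least)
        show "a \<sqsubseteq>\<^bsub>L\<^esub> x" if "a \<in> A" for a
          using I[OF that] \<open>b \<noteq> \<bottom>\<^bsub>M\<^esub>\<close> x by auto
      qed (use A x in auto)
      then show ?thesis
        using True A b by auto
    next
      case False
      then have "A \<subseteq> {\<bottom>\<^bsub>L\<^esub>}"
        using I by auto
      then show ?thesis
        using A b by (simp add: bot_L)
    qed
  next
    fix a B assume a: "a \<in> carrier L" and B: "B \<subseteq> carrier M" and I: "\<And>b. b \<in> B \<Longrightarrow> (a, b) \<in> ?R"
    show "(a, \<Squnion>\<^bsub>M\<^esub>B) \<in> ?R"
    proof (cases "a \<sqsubseteq>\<^bsub>L\<^esub> x \<or> a = \<bottom>\<^bsub>L\<^esub>")
      case True
      have "\<Squnion>\<^bsub>M\<^esub>B \<sqsubseteq>\<^bsub>M\<^esub> y" if "a \<noteq> \<bottom>\<^bsub>L\<^esub>"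
      proof (intro M.sup_least)
        show "b \<sqsubseteq>\<^bsub>M\<^esub> y" if "b \<in> B" for b
          using I[OF that] \<open>a \<noteq> \<bottom>\<^bsub>L\<^esub>\<close> y by auto
      qed (use B y in auto)
      then show ?thesis
        using True B a by auto
    next
      case False
      then have "B \<subseteq> {\<bottom>\<^bsub>M\<^esub>}"
        using I by auto
      then show ?thesis
        using B a by (simp add: bot_M)
    qed
  qed auto
  then show "x \<otimes> y \<subseteq> ?R"
    using x y by (simp add: rect_le_iff)
  show "?R \<subseteq> x \<otimes> y"
    using x y by (auto simp: rect_def intro: coprod_idealD(2) ideal_bottom)
qed

lemma ideal_rect: "x \<in> carrier L \<Longrightarrow> y \<in> carrier M \<Longrightarrow> coprod_ideal L M (x \<otimes> y)"
  unfolding rect_def using ideal_full by (intro coprod_ideal_Inter) auto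

lemma rect_mono:
  assumes "x \<in> carrier L" "y \<in> carrier M" "x' \<in> carrier L" "y' \<in> carrier M"
    and "x \<sqsubseteq>\<^bsub>L\<^esub> x'" "y \<sqsubseteq>\<^bsub>M\<^esub> y'"
  shows "x \<otimes> y \<subseteq> x' \<otimes> y'"
  unfolding rect_le_iff[OF ideal_rect[OF assms(3,4)]] using assms by (simp add: rect_eq)

lemma rect_Int:
  assumes "x \<in> carrier L" "y \<in> carrier M" "x' \<in> carrier L" "y' \<in> carrier M"
  shows "x \<otimes> y \<inter> x' \<otimes> y' = (x \<sqinter>\<^bsub>L\<^esub> x') \<otimes> (y \<sqinter>\<^bsub>M\<^esub> y')"
proof (rule Set.set_eqI, unfold split_paired_all)
  fix a b
  show "(a, b) \<in> x \<otimes> y \<inter> x' \<otimes> y' \<longleftrightarrow> (a, b) \<in> (x \<sqinter>\<^bsub>L\<^esub> x') \<otimes> (y \<sqinter>\<^bsub>M\<^esub> y')"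
    using assms by (cases "a \<in> carrier L \<and> b \<in> carrier M")
      (simp add: rect_eq L.le_meet_iff M.le_meet_iff; blast)+
qed

lemma rect_top: "\<top>\<^bsub>L\<^esub> \<otimes> \<top>\<^bsub>M\<^esub> = carrier L \<times> carrier M"
  by (auto simp: rect_eq)

text \<open>For an ideal \<open>E\<close>, down-closure and closure under joins in the first
  variable make \<open>(\<Squnion>A, y) \<in> E\<close> equivalent to \<open>(a, y) \<in> E\<close>
  for all \<open>a\<close> in \<open>A\<close>. The two sides thus have the same upper
  bounds.\<close>

lemma rect_sup_left:
  assumes A: "A \<subseteq> carrier L" and y: "y \<in> carrier M"
  shows "(\<Squnion>\<^bsub>L\<^esub>A) \<otimes> y = \<Squnion>\<^bsub>C\<^esub>((\<lambda>a. a \<otimes> y) ` A)"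
proof (rule C.eq_if_same_upper_bounds)
  have R: "(\<lambda>a. a \<otimes> y) ` A \<subseteq> carrier C"
    using A y by (auto intro: ideal_rect)
  then show "\<Squnion>\<^bsub>C\<^esub>((\<lambda>a. a \<otimes> y) ` A) \<in> carrier C"
    by (rule C.sup_closed)
  show "\<Squnion>\<^bsub>L\<^esub>A \<otimes> y \<in> carrier C"
    using A y by (simp add: ideal_rect)
  fix E assume "E \<in> carrier C"
  then have E: "coprod_ideal L M E" by simp
  have "(\<Squnion>\<^bsub>L\<^esub>A, y) \<in> E \<longleftrightarrow> (\<forall>a\<in>A. (a, y) \<in> E)"
    using A y coprod_idealD(3)[OF E] coprod_idealD(2)[OF E] L.sup_upper[OF A]
    by (meson M.le_refl subsetD)
  then show "\<Squnion>\<^bsub>L\<^esub>A \<otimes> y \<sqsubseteq>\<^bsub>C\<^esub> E \<longleftrightarrow> \<Squnion>\<^bsub>C\<^esub>((\<lambda>a. a \<otimes> y) ` A) \<sqsubseteq>\<^bsub>C\<^esub> E"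
    using R E by (simp add: sup_coprod_le_iff rect_le_iff)
qed

lemma rect_sup_right:
  assumes x: "x \<in> carrier L" and B: "B \<subseteq> carrier M"
  shows "x \<otimes> (\<Squnion>\<^bsub>M\<^esub>B) = \<Squnion>\<^bsub>C\<^esub>((\<lambda>b. x \<otimes> b) ` B)"
proof (rule C.eq_if_same_upper_bounds)
  have R: "(\<lambda>b. x \<otimes> b) ` B \<subseteq> carrier C"
    using B x by (auto intro: ideal_rect)
  then show "\<Squnion>\<^bsub>C\<^esub>((\<lambda>b. x \<otimes> b) ` B) \<in> carrier C"
    by (rule C.sup_closed)
  show "x \<otimes> \<Squnion>\<^bsub>M\<^esub>B \<in> carrier C"
    using B x by (simp add: ideal_rect)
  fix E assume "E \<in> carrier C"
  then have E: "coprod_ideal L M E" by simp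
  have "(x, \<Squnion>\<^bsub>M\<^esub>B) \<in> E \<longleftrightarrow> (\<forall>b\<in>B. (x, b) \<in> E)"
    using B x coprod_idealD(4)[OF E] coprod_idealD(2)[OF E] M.sup_upper[OF B]
    by (meson L.le_refl subsetD)
  then show "x \<otimes> \<Squnion>\<^bsub>M\<^esub>B \<sqsubseteq>\<^bsub>C\<^esub> E \<longleftrightarrow> \<Squnion>\<^bsub>C\<^esub>((\<lambda>b. x \<otimes> b) ` B) \<sqsubseteq>\<^bsub>C\<^esub> E"
    using R E by (simp add: sup_coprod_le_iff rect_le_iff)
qed

text \<open>Rectangles generate under joins, so an inequality in the quotient can later be checked
  rectangle by rectangle.\<close>

lemma sup_rects:
  assumes D: "coprod_ideal L M D"
  shows "\<Squnion>\<^bsub>C\<^esub>((\<lambda>(x, y). x \<otimes> y) ` D) = D"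
proof (rule C.sup_eqI)
  show "(\<lambda>(x, y). x \<otimes> y) ` D \<subseteq> carrier C"
    using coprod_idealD(1)[OF D] by (auto intro!: ideal_rect)
  show "R \<sqsubseteq>\<^bsub>C\<^esub> D" if "R \<in> (\<lambda>(x, y). x \<otimes> y) ` D" for R
    using that by (auto simp: rect_le_iff[OF D, THEN iffD2, THEN subsetD])
  show "D \<sqsubseteq>\<^bsub>C\<^esub> E" if "E \<in> carrier C" "\<And>R. R \<in> (\<lambda>(x, y). x \<otimes> y) ` D \<Longrightarrow> R \<sqsubseteq>\<^bsub>C\<^esub> E" for E
  proof -
    have "(x, y) \<in> E" if "(x, y) \<in> D" for x y
      using that \<open>\<And>R. R \<in> (\<lambda>(x, y). x \<otimes> y) ` D \<Longrightarrow> R \<sqsubseteq>\<^bsub>C\<^esub> E\<close>[of "x \<otimes> y"] \<open>E \<in> carrier C\<close>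
      by (auto simp: rect_le_iff)
    then show ?thesis
      by auto
  qed
qed (use D in simp)

lemma rect_left_frame_homs: "(\<lambda>x\<in>carrier L. x \<otimes> \<top>\<^bsub>M\<^esub>) \<in> frame_homs L C"
proof (rule frame_homsI)
  show "(\<lambda>x\<in>carrier L. x \<otimes> \<top>\<^bsub>M\<^esub>) (\<Squnion>\<^bsub>L\<^esub>A) = \<Squnion>\<^bsub>C\<^esub>((\<lambda>x\<in>carrier L. x \<otimes> \<top>\<^bsub>M\<^esub>) ` A)"
    if "A \<subseteq> carrier L" for A
    using that by (simp add: rect_sup_left subset_iff cong: image_cong_simp)
qed (auto simp: ideal_rect rect_top top_coprod meet_coprod rect_Int M.meet_absorb
    intro: L.complete_lattice C.complete_lattice)

lemma rect_right_frame_homs: "(\<lambda>y\<in>carrier M. \<top>\<^bsub>L\<^esub> \<otimes> y) \<in> frame_homs M C"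
proof (rule frame_homsI)
  show "(\<lambda>y\<in>carrier M. \<top>\<^bsub>L\<^esub> \<otimes> y) (\<Squnion>\<^bsub>M\<^esub>A) = \<Squnion>\<^bsub>C\<^esub>((\<lambda>y\<in>carrier M. \<top>\<^bsub>L\<^esub> \<otimes> y) ` A)"
    if "A \<subseteq> carrier M" for A
    using that by (simp add: rect_sup_right subset_iff cong: image_cong_simp)
qed (auto simp: ideal_rect rect_top top_coprod meet_coprod rect_Int L.meet_absorb
    intro: M.complete_lattice C.complete_lattice)

end

section \<open>Functoriality of the coproduct: the inverse image of a product map\<close>

locale frame_hom_pair =
  frame_pair L M + cod: frame_pair L' M'
  for L :: "'a gorder" and M :: "'b gorder" and L' :: "'c gorder" and M' :: "'d gorder" +
  fixes h k
  assumes h: "h \<in> frame_homs L L'" and k: "k \<in> frame_homs M M'"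
begin

abbreviation C' where "C' \<equiv> coprod L' M'"
abbreviation H where "H \<equiv> coprod_map L M L' M' h k"

lemma rects_closed:
  assumes "D \<subseteq> carrier L \<times> carrier M"
  shows "{rect L' M' (h x) (k y) | x y. (x, y) \<in> D} \<subseteq> carrier C'"
  using assms frame_homsD(2)[OF h] frame_homsD(2)[OF k] by (auto intro!: cod.ideal_rect)

lemma ideal_map:
  assumes "coprod_ideal L M D"
  shows "coprod_ideal L' M' (H D)"
  using cod.ideal_sup_coprod[OF rects_closed[OF coprod_idealD(1)[OF assms]]] assms
  by (simp add: coprod_map_def)

lemma map_le_iff:
  assumes D: "coprod_ideal L M D" and E: "coprod_ideal L' M' E"
  shows "H D \<subseteq> E \<longleftrightarrow> (\<forall>(x, y)\<in>D. (h x, k y) \<in> E)"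
proof -
  have "H D \<subseteq> E \<longleftrightarrow> (\<forall>R\<in>{rect L' M' (h x) (k y) | x y. (x, y) \<in> D}. R \<subseteq> E)"
    using D E cod.sup_coprod_le_iff[OF rects_closed[OF coprod_idealD(1)[OF D]]]
    by (simp add: coprod_map_def)
  also have "\<dots> \<longleftrightarrow> (\<forall>x y. (x, y) \<in> D \<longrightarrow> rect L' M' (h x) (k y) \<subseteq> E)"
    by blast
  also have "\<dots> \<longleftrightarrow> (\<forall>(x, y)\<in>D. (h x, k y) \<in> E)"
    using E by (auto simp: cod.rect_le_iff)
  finally show ?thesis .
qed

lemma map_memI: "coprod_ideal L M D \<Longrightarrow> (x, y) \<in> D \<Longrightarrow> (h x, k y) \<in> H D"
  using map_le_iff[OF _ ideal_map] by blast

lemma map_mono: "coprod_ideal L M D \<Longrightarrow> coprod_ideal L M E \<Longrightarrow> D \<subseteq> E \<Longrightarrow> H D \<subseteq> H E"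
  using map_memI by (subst map_le_iff) (auto intro: ideal_map)

text \<open>This preimage is the value at \<open>E\<close> of the right adjoint of \<open>H\<close>,
  as \<open>map_le_iff'\<close> shows; preservation of joins by \<open>H\<close> is then
  formal.\<close>

lemma ideal_preimage:
  assumes E: "coprod_ideal L' M' E"
  shows "coprod_ideal L M {(x, y) \<in> carrier L \<times> carrier M. (h x, k y) \<in> E}" (is "coprod_ideal L M ?P")
proof (rule coprod_idealI)
  fix x y x' y'
  assume "(x, y) \<in> ?P" "x' \<in> carrier L" "y' \<in> carrier M" "x' \<sqsubseteq>\<^bsub>L\<^esub> x" "y' \<sqsubseteq>\<^bsub>M\<^esub> y"
  then show "(x', y') \<in> ?P"
    using coprod_idealD(2)[OF E, of "h x" "k y" "h x'" "k y'"] frame_homsD(2)[OF h] frame_homsD(2)[OF k]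
      frame_homs_mono[OF h] frame_homs_mono[OF k] by simp
next
  fix A y assume A: "A \<subseteq> carrier L" and y: "y \<in> carrier M" and P: "\<And>a. a \<in> A \<Longrightarrow> (a, y) \<in> ?P"
  have "(\<Squnion>\<^bsub>L'\<^esub>(h ` A), k y) \<in> E"
    using A y P frame_homsD(2)[OF h] frame_homsD(2)[OF k] by (intro coprod_idealD(3)[OF E]) auto
  then show "(\<Squnion>\<^bsub>L\<^esub>A, y) \<in> ?P"
    using A y by (simp add: frame_homsD(5)[OF h])
next
  fix x B assume x: "x \<in> carrier L" and B: "B \<subseteq> carrier M" and P: "\<And>b. b \<in> B \<Longrightarrow> (x, b) \<in> ?P"
  have "(h x, \<Squnion>\<^bsub>M'\<^esub>(k ` B)) \<in> E"
    using B x P frame_homsD(2)[OF h] frame_homsD(2)[OF k] by (intro coprod_idealD(4)[OF E]) auto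
  then show "(x, \<Squnion>\<^bsub>M\<^esub>B) \<in> ?P"
    using B x by (simp add: frame_homsD(5)[OF k])
qed auto

lemma map_le_iff':
  assumes D: "coprod_ideal L M D" and E: "coprod_ideal L' M' E"
  shows "H D \<subseteq> E \<longleftrightarrow> D \<subseteq> {(x, y) \<in> carrier L \<times> carrier M. (h x, k y) \<in> E}"
  using coprod_idealD(1)[OF D] by (auto simp: map_le_iff[OF assms])

lemma map_rect:
  assumes "x \<in> carrier L" "y \<in> carrier M"
  shows "H (x \<otimes> y) = rect L' M' (h x) (k y)"
proof (rule cod.C.eq_if_same_upper_bounds)
  fix E assume "E \<in> carrier C'"
  then have E: "coprod_ideal L' M' E" by simp
  have "H (x \<otimes> y) \<subseteq> E \<longleftrightarrow> x \<otimes> y \<subseteq> {(x, y) \<in> carrier L \<times> carrier M. (h x, k y) \<in> E}"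
    using assms by (intro map_le_iff' ideal_rect E)
  also have "\<dots> \<longleftrightarrow> (x, y) \<in> {(x, y) \<in> carrier L \<times> carrier M. (h x, k y) \<in> E}"
    by (rule rect_le_iff[OF ideal_preimage[OF E]])
  also have "\<dots> \<longleftrightarrow> rect L' M' (h x) (k y) \<subseteq> E"
    using assms E by (simp add: cod.rect_le_iff)
  finally show "H (x \<otimes> y) \<sqsubseteq>\<^bsub>C'\<^esub> E \<longleftrightarrow> rect L' M' (h x) (k y) \<sqsubseteq>\<^bsub>C'\<^esub> E"
    by simp
qed (use assms frame_homsD(2)[OF h] frame_homsD(2)[OF k] in
    \<open>auto intro!: ideal_map ideal_rect cod.ideal_rect\<close>)

lemma map_sup:
  assumes \<D>: "\<D> \<subseteq> carrier C"
  shows "H (\<Squnion>\<^bsub>C\<^esub>\<D>) = \<Squnion>\<^bsub>C'\<^esub>(H ` \<D>)"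
proof (rule cod.C.eq_if_same_upper_bounds)
  have H: "H ` \<D> \<subseteq> carrier C'"
    using \<D> by (auto intro: ideal_map)
  then show "\<Squnion>\<^bsub>C'\<^esub>(H ` \<D>) \<in> carrier C'"
    by (rule cod.C.sup_closed)
  show "H (\<Squnion>\<^bsub>C\<^esub>\<D>) \<in> carrier C'"
    using ideal_map[OF ideal_sup_coprod[OF \<D>]] by simp
  fix E assume E: "E \<in> carrier C'"
  have "H (\<Squnion>\<^bsub>C\<^esub>\<D>) \<subseteq> E \<longleftrightarrow> \<Squnion>\<^bsub>C\<^esub>\<D> \<subseteq> {(x, y) \<in> carrier L \<times> carrier M. (h x, k y) \<in> E}"
    using E by (intro map_le_iff' ideal_sup_coprod[OF \<D>]) simp
  also have "\<dots> \<longleftrightarrow> (\<forall>D\<in>\<D>. D \<subseteq> {(x, y) \<in> carrier L \<times> carrier M. (h x, k y) \<in> E})"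
    using E by (intro sup_coprod_le_iff[OF \<D>] ideal_preimage) simp
  also have "\<dots> \<longleftrightarrow> (\<forall>D\<in>\<D>. H D \<subseteq> E)"
    using \<D> E by (intro ball_cong refl map_le_iff'[symmetric]) auto
  also have "\<dots> \<longleftrightarrow> \<Squnion>\<^bsub>C'\<^esub>(H ` \<D>) \<subseteq> E"
    using H E by (subst cod.sup_coprod_le_iff) auto
  finally show "H (\<Squnion>\<^bsub>C\<^esub>\<D>) \<sqsubseteq>\<^bsub>C'\<^esub> E \<longleftrightarrow> \<Squnion>\<^bsub>C'\<^esub>(H ` \<D>) \<sqsubseteq>\<^bsub>C'\<^esub> E"
    by simp
qed

text \<open>Preservation of meets does not follow from the adjunction. The required membership holds
  for generating pairs by \<open>basic\<close>, and implication ideals extend it to all of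
  \<open>H D\<close> and \<open>H E\<close>, one argument at a time.\<close>

lemma map_Int:
  assumes D: "coprod_ideal L M D" and E: "coprod_ideal L M E"
  shows "H (D \<inter> E) = H D \<inter> H E"
proof
  show "H (D \<inter> E) \<subseteq> H D \<inter> H E"
    using map_mono D E ideal_Int[OF D E] by simp
  let ?F = "H (D \<inter> E)"
  let ?I = "\<lambda>A. {(x, y) \<in> carrier L' \<times> carrier M'. \<forall>(a, b)\<in>A. (x \<sqinter>\<^bsub>L'\<^esub> a, y \<sqinter>\<^bsub>M'\<^esub> b) \<in> ?F}"
  have F: "coprod_ideal L' M' ?F"
    by (intro ideal_map ideal_Int D E)
  note sub = coprod_idealD(1)[OF D] coprod_idealD(1)[OF E]
  have basic: "(h x \<sqinter>\<^bsub>L'\<^esub> h x', k y \<sqinter>\<^bsub>M'\<^esub> k y') \<in> ?F" if D': "(x, y) \<in> D" and E': "(x', y') \<in> E" for x y x' y'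
  proof -
    have carr: "x \<in> carrier L" "y \<in> carrier M" "x' \<in> carrier L" "y' \<in> carrier M"
      using D' E' sub by auto
    then have "(x \<sqinter>\<^bsub>L\<^esub> x', y \<sqinter>\<^bsub>M\<^esub> y') \<in> D \<inter> E"
      using coprod_idealD(2)[OF D D'] coprod_idealD(2)[OF E E']
      by (simp add: L.meet_left L.meet_right M.meet_left M.meet_right)
    then show ?thesis
      using map_memI[OF ideal_Int[OF D E]] carr frame_homsD(6)[OF h] frame_homsD(6)[OF k] by metis
  qed
  \<comment> \<open>Here the second argument still runs over the images of pairs of \<open>E\<close>
    only, while the first is extended to \<open>H D\<close>. Afterwards the second is extended to
    \<open>H E\<close>.\<close>
  have I: "coprod_ideal L' M' (?I {(h x, k y) | x y. (x, y) \<in> E})"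
    using sub(2) frame_homsD(2)[OF h] frame_homsD(2)[OF k] by (intro cod.ideal_imp F) auto
  then have HD: "H D \<subseteq> ?I {(h x, k y) | x y. (x, y) \<in> E}"
    unfolding map_le_iff[OF D I] using basic sub(1) frame_homsD(2)[OF h] frame_homsD(2)[OF k] by auto
  have "(h x, k y) \<in> ?I (H D)" if xy: "(x, y) \<in> E" for x y
  proof -
    have "(h x \<sqinter>\<^bsub>L'\<^esub> a, k y \<sqinter>\<^bsub>M'\<^esub> b) \<in> ?F" if "(a, b) \<in> H D" for a b
    proof -
      have "(a \<sqinter>\<^bsub>L'\<^esub> h x, b \<sqinter>\<^bsub>M'\<^esub> k y) \<in> ?F"
        using subsetD[OF HD that] xy by blast
      then show ?thesis
        by (simp only: meet_comm)
    qed
    then show ?thesis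
      using xy sub(2) frame_homsD(2)[OF h] frame_homsD(2)[OF k] by auto
  qed
  then have HE: "H E \<subseteq> ?I (H D)"
    unfolding map_le_iff[OF E cod.ideal_imp[OF coprod_idealD(1)[OF ideal_map[OF D]] F]] by blast
  show "H D \<inter> H E \<subseteq> H (D \<inter> E)"
  \<comment> \<open>As in the distributive law, a common pair is met with itself.\<close>
  proof clarify
    fix a b assume ab: "(a, b) \<in> H D" "(a, b) \<in> H E"
    then have "(a \<sqinter>\<^bsub>L'\<^esub> a, b \<sqinter>\<^bsub>M'\<^esub> b) \<in> ?F"
      using HE by blast
    moreover have "a \<in> carrier L'" "b \<in> carrier M'"
      using ab(1) coprod_idealD(1)[OF ideal_map[OF D]] by auto
    ultimately show "(a, b) \<in> ?F"
      by (simp add: cod.L.meet_absorb cod.M.meet_absorb)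
  qed
qed

lemma map_frame_homs: "H \<in> frame_homs C C'"
proof (rule frame_homsI)
  show "H \<in> carrier C \<rightarrow>\<^sub>E carrier C'"
    using ideal_map by (auto simp: coprod_map_def)
  show "H \<top>\<^bsub>C\<^esub> = \<top>\<^bsub>C'\<^esub>"
    using map_rect[of "\<top>\<^bsub>L\<^esub>" "\<top>\<^bsub>M\<^esub>"] frame_homsD(7)[OF h] frame_homsD(7)[OF k]
    by (simp add: rect_top cod.rect_top top_coprod cod.top_coprod)
qed (auto simp: map_sup map_Int meet_coprod cod.meet_coprod ideal_map
    intro: C.complete_lattice cod.C.complete_lattice)

end

lemma coprod_map_id:
  assumes "frame L" "frame M" "coprod_ideal L M D"
  shows "coprod_map L M L M (\<lambda>x\<in>carrier L. x) (\<lambda>x\<in>carrier M. x) D = D"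
proof -
  interpret frame_pair L M
    using assms by (simp add: frame_pair_def)
  interpret frame_hom_pair L M L M "\<lambda>x\<in>carrier L. x" "\<lambda>x\<in>carrier M. x"
    by unfold_locales (auto intro: id_frame_homs L.complete_lattice M.complete_lattice)
  show ?thesis
    using coprod_idealD(1)[OF assms(3)] assms(3)
    by (intro C.eq_if_same_upper_bounds) (auto simp: map_le_iff' ideal_map)
qed

text \<open>The preimage of an ideal under a composite is the iterated preimage, so both sides have
  the same upper bounds.\<close>

lemma coprod_map_compose:
  assumes "frame L" "frame M" "frame L'" "frame M'" "frame L''" "frame M''"
    and "f \<in> frame_homs L' L''" "f' \<in> frame_homs L L'" "g \<in> frame_homs M' M''" "g' \<in> frame_homs M M'"
    and D: "coprod_ideal L M D"
  shows "coprod_map L M L'' M'' (compose (carrier L) f f') (compose (carrier M) g g') D =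
    coprod_map L' M' L'' M'' f g (coprod_map L M L' M' f' g' D)"
proof -
  interpret fg': frame_hom_pair L M L' M' f' g'
    using assms by (simp add: frame_hom_pair_def frame_pair_def frame_hom_pair_axioms_def)
  interpret fg: frame_hom_pair L' M' L'' M'' f g
    using assms by (simp add: frame_hom_pair_def frame_pair_def frame_hom_pair_axioms_def)
  interpret comp: frame_hom_pair L M L'' M'' "compose (carrier L) f f'" "compose (carrier M) g g'"
    using assms by (simp add: frame_hom_pair_def frame_pair_def frame_hom_pair_axioms_def compose_frame_homs)
  note ideal = fg'.ideal_map[OF D]
  show ?thesis
  proof (rule fg.cod.C.eq_if_same_upper_bounds)
    fix E assume "E \<in> carrier (coprod L'' M'')"
    then have E: "coprod_ideal L'' M'' E" by simp
    have "comp.H D \<subseteq> E \<longleftrightarrow> (\<forall>(x, y)\<in>D. (f (f' x), g (g' y)) \<in> E)"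
      unfolding comp.map_le_iff[OF D E] using coprod_idealD(1)[OF D]
      by (intro ball_cong refl) (auto simp: compose_def)
    also have "\<dots> \<longleftrightarrow> (\<forall>(x, y)\<in>D. (f' x, g' y) \<in> {(x, y) \<in> carrier L' \<times> carrier M'. (f x, g y) \<in> E})"
      using coprod_idealD(1)[OF D] frame_homsD(2)[OF assms(8)] frame_homsD(2)[OF assms(10)]
      by (intro ball_cong refl) auto
    also have "\<dots> \<longleftrightarrow> fg'.H D \<subseteq> {(x, y) \<in> carrier L' \<times> carrier M'. (f x, g y) \<in> E}"
      by (rule fg'.map_le_iff[OF D fg.ideal_preimage[OF E], symmetric])
    also have "\<dots> \<longleftrightarrow> fg.H (fg'.H D) \<subseteq> E"
      by (rule fg.map_le_iff'[OF ideal E, symmetric])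
    finally show "comp.H D \<sqsubseteq>\<^bsub>coprod L'' M''\<^esub> E \<longleftrightarrow> fg.H (fg'.H D) \<sqsubseteq>\<^bsub>coprod L'' M''\<^esub> E"
      by simp
  qed (use comp.ideal_map[OF D] fg.ideal_map[OF ideal] in simp_all)
qed

section \<open>Localic relations\<close>

text \<open>Closure under meets holds because the other factor can be absorbed into the test element
  \<open>w\<close>; closure under joins, because distributivity moves \<open>w\<close> inside the
  join. Taking \<open>w\<close> to be the top element shows that the relation lies in the kernel of
  \<open>e\<close>.\<close>

lemma kernel_congruence:
  fixes L (structure)
  assumes L: "frame L"
    and e: "\<And>A. A \<subseteq> carrier L \<Longrightarrow> e (\<Squnion>A) = \<Squnion>\<^bsub>K\<^esub>(e ` A)"
  shows "frame_congruence L
    {(u, v) \<in> carrier L \<times> carrier L. \<forall>w\<in>carrier L. e (u \<sqinter> w) = e (v \<sqinter> w)}"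
    (is "frame_congruence L ?T")
proof -
  interpret frame L by fact
  show ?thesis
  proof (rule frame_congruenceI)
    show "equiv (carrier L) ?T"
      by (auto simp: equiv_def refl_on_def sym_def trans_def)
    show "(a \<sqinter> c, b \<sqinter> d) \<in> ?T" if "(a, b) \<in> ?T" "(c, d) \<in> ?T" for a b c d
    proof -
      have carr: "a \<in> carrier L" "b \<in> carrier L" "c \<in> carrier L" "d \<in> carrier L"
        using that by auto
      have "e (a \<sqinter> c \<sqinter> w) = e (b \<sqinter> d \<sqinter> w)" if w: "w \<in> carrier L" for w
      proof -
        have "e (a \<sqinter> c \<sqinter> w) = e (b \<sqinter> (c \<sqinter> w))"
          using \<open>(a, b) \<in> ?T\<close> carr w by (simp add: meet_assoc)
        also have "\<dots> = e (c \<sqinter> (b \<sqinter> w))"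
          using carr w by (metis meet_assoc meet_comm)
        also have "\<dots> = e (d \<sqinter> (b \<sqinter> w))"
          using \<open>(c, d) \<in> ?T\<close> carr w by simp
        also have "\<dots> = e (b \<sqinter> d \<sqinter> w)"
          using carr w by (metis meet_assoc meet_comm)
        finally show ?thesis .
      qed
      then show ?thesis
        using carr by simp
    qed
    fix S assume S: "S \<subseteq> ?T"
    then have carr: "fst ` S \<subseteq> carrier L" "snd ` S \<subseteq> carrier L"
      by auto
    have distrib: "e (\<Squnion>A \<sqinter> w) = \<Squnion>\<^bsub>K\<^esub>((\<lambda>a. e (a \<sqinter> w)) ` A)"
      if "A \<subseteq> carrier L" "w \<in> carrier L" for A w
    proof -
      have "(\<lambda>a. a \<sqinter> w) ` A \<subseteq> carrier L"
        using that by auto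
      then show ?thesis
        using that by (simp add: meet_Sup_distrib' e image_image)
    qed
    have "e (\<Squnion>(fst ` S) \<sqinter> w) = e (\<Squnion>(snd ` S) \<sqinter> w)" if w: "w \<in> carrier L" for w
    proof -
      have "(\<lambda>a. e (a \<sqinter> w)) ` fst ` S = (\<lambda>a. e (a \<sqinter> w)) ` snd ` S"
        unfolding image_image using S w by (intro image_cong) auto
      then show ?thesis
        using carr w by (simp add: distrib)
    qed
    then show "(\<Squnion>(fst ` S), \<Squnion>(snd ` S)) \<in> ?T"
      using carr by simp
  qed
qed

locale localic_relation = L: frame L for L :: "'a gorder" +
  fixes R
  assumes congruence_R: "frame_congruence (coprod L L) R"
begin

sublocale frame_pair L L ..

abbreviation tensor (infixl \<open>\<otimes>\<close> 75) where "x \<otimes> y \<equiv> rect L L x y"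

sublocale R: lattice_congruence "coprod L L" R
  by unfold_locales (rule congruence_R)

end

context localic_relation
begin

lemma source_eq: "source L R = compose (carrier L) R.q (\<lambda>x\<in>carrier L. x \<otimes> \<top>\<^bsub>L\<^esub>)"
  by (auto simp: source_def compose_def fun_eq_iff)

lemma target_eq: "target L R = compose (carrier L) R.q (\<lambda>y\<in>carrier L. \<top>\<^bsub>L\<^esub> \<otimes> y)"
  by (auto simp: target_def compose_def fun_eq_iff)

lemma source_frame_homs: "source L R \<in> frame_homs L (rel_frame L R)"
  unfolding source_eq by (rule compose_frame_homs[OF R.q_frame_homs rect_left_frame_homs])

lemma target_frame_homs: "target L R \<in> frame_homs L (rel_frame L R)"
  unfolding target_eq by (rule compose_frame_homs[OF R.q_frame_homs rect_right_frame_homs])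

lemma q_le_source_iff:
  assumes "coprod_ideal L L D" "z \<in> carrier L"
  shows "R.q D \<sqsubseteq>\<^bsub>rel_frame L R\<^esub> source L R z \<longleftrightarrow> (D, D \<inter> z \<otimes> \<top>\<^bsub>L\<^esub>) \<in> R"
  using assms by (simp add: source_def R.q_le_iff ideal_rect meet_coprod)

text \<open>The meet of \<open>\<top> \<otimes> y\<close> with \<open>z \<otimes> \<top>\<close> is
  \<open>z \<otimes> y\<close>. An inequality between opens of the relation becomes a pair of
  rectangles, on which monotone maps can act.\<close>

lemma target_le_source_iff:
  assumes "y \<in> carrier L" "z \<in> carrier L"
  shows "target L R y \<sqsubseteq>\<^bsub>rel_frame L R\<^esub> source L R z \<longleftrightarrow> (\<top>\<^bsub>L\<^esub> \<otimes> y, z \<otimes> y) \<in> R"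
  using assms q_le_source_iff[of "\<top>\<^bsub>L\<^esub> \<otimes> y" z] L.meet_absorb[of z "\<top>\<^bsub>L\<^esub>"] L.meet_absorb[of y "\<top>\<^bsub>L\<^esub>"]
  by (simp add: target_def ideal_rect rect_Int meet_comm[of L "\<top>\<^bsub>L\<^esub>"])

end

text \<open>The universal property of the quotient replaces the restriction map by the condition
  that \<open>f \<times> f\<close> respects the congruences, which can be tested on generators and
  composes directly.\<close>

lemma monotone_map_iff:
  assumes "localic_relation L R" "localic_relation M Q"
  shows "monotone_map L R M Q h \<longleftrightarrow> h \<in> frame_homs M L \<and>
    (\<forall>(u, v)\<in>Q. (coprod_map M M L L h h u, coprod_map M M L L h h v) \<in> R)"
proof (cases "h \<in> frame_homs M L")
  case h: True
  interpret R: localic_relation L R by fact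
  interpret Q: localic_relation M Q by fact
  interpret frame_hom_pair M M L L h h
    by unfold_locales (rule h)+
  show ?thesis
  proof (intro iffI conjI ballI; (elim conjE)?)
    assume "monotone_map L R M Q h"
    then obtain g where g: "\<And>u. coprod_ideal M M u \<Longrightarrow> g (Q.R.q u) = R.R.q (H u)"
      by (auto simp: monotone_map_def)
    have "(H u, H v) \<in> R" if uv: "(u, v) \<in> Q" for u v
    proof -
      have ideals: "coprod_ideal M M u" "coprod_ideal M M v"
        using Q.R.cong_carrier[OF uv] by auto
      then have "Q.R.q u = Q.R.q v"
        using uv by (simp add: Q.R.q_eq_iff)
      then have "R.R.q (H u) = R.R.q (H v)"
        using g ideals by metis
      then show ?thesis
        using ideals by (simp add: R.R.q_eq_iff ideal_map)
    qed
    then show "case uv of (u, v) \<Rightarrow> (H u, H v) \<in> R" if "uv \<in> Q" for uv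
      using that by auto
  next
    assume resp: "\<forall>(u, v)\<in>Q. (H u, H v) \<in> R"
    let ?k = "compose (carrier (coprod M M)) R.R.q H"
    have k: "?k \<in> frame_homs (coprod M M) (rel_frame L R)"
      by (rule compose_frame_homs[OF R.R.q_frame_homs map_frame_homs])
    have "?k u = ?k v" if uv: "(u, v) \<in> Q" for u v
      using uv resp Q.R.cong_carrier[OF uv] by (auto simp: compose_def R.R.q_eq_iff ideal_map)
    from Q.R.factor_through_q[OF k this] show "monotone_map L R M Q h"
      using h by (auto simp: monotone_map_def compose_def)
  qed (rule h)
qed (simp add: monotone_map_def)

section \<open>Induced cones\<close>

text \<open>The Galois property fixes the upper bounds of each value, so lower adjoints agree on the
  carrier. Restricting \<open>g\<close> to the carrier gives the one extensional function that the
  definite description selects.\<close>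

lemma left_adjoint_eq:
  assumes g: "galois_connection \<lparr>orderA = M, orderB = L, lower = g, upper = h\<rparr>" and u: "u \<in> carrier M"
  shows "left_adjoint L M h u = g u"
proof -
  have L: "partial_order L"
    using g by (auto simp: galois_connection_def connection_def)
  have unique: "f v = g v"
    if f: "galois_connection \<lparr>orderA = M, orderB = L, lower = f, upper = h\<rparr>" and v: "v \<in> carrier M" for f v
    using galois_connection.galois_property[OF f] galois_connection.galois_property[OF g]
      connection.lower_closed[OF galois_connection.axioms(1)[OF f]]
      connection.lower_closed[OF galois_connection.axioms(1)[OF g]] v
    by (intro partial_order.eq_if_same_upper_bounds[OF L]) auto
  have "left_adjoint L M h = restrict g (carrier M)"
    unfolding left_adjoint_def
  proof (rule the_equality)
    show "restrict g (carrier M) \<in> extensional (carrier M) \<and>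
      galois_connection \<lparr>orderA = M, orderB = L, lower = restrict g (carrier M), upper = h\<rparr>"
      using g by (auto simp: galois_connection_def galois_connection_axioms_def connection_def)
    show "f = restrict g (carrier M)"
      if "f \<in> extensional (carrier M) \<and> galois_connection \<lparr>orderA = M, orderB = L, lower = f, upper = h\<rparr>" for f
      using that unique by (intro extensionalityI[of _ "carrier M"]) auto
  qed
  then show ?thesis
    using u by simp
qed

locale open_localic_relation = localic_relation +
  assumes open_R: "open_source L R"
begin

abbreviation cone where "cone \<equiv> induced_cone L R"

lemma cone_props:
  assumes y: "y \<in> carrier L"
  shows cone_closed: "cone y \<in> carrier L"
    and cone_le_iff_target: "z \<in> carrier L \<Longrightarrow> cone y \<sqsubseteq>\<^bsub>L\<^esub> z \<longleftrightarrow> target L R y \<sqsubseteq>\<^bsub>rel_frame L R\<^esub> source L R z"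
proof -
  obtain g where g: "galois_connection \<lparr>orderA = rel_frame L R, orderB = L, lower = g, upper = source L R\<rparr>"
    using open_R by (auto simp: open_source_def open_locale_map_def)
  have y': "target L R y \<in> carrier (rel_frame L R)"
    using y by (rule frame_homsD(2)[OF target_frame_homs])
  then have cone: "cone y = g (target L R y)"
    using y left_adjoint_eq[OF g] by (simp add: induced_cone_def compose_def)
  show "cone y \<in> carrier L"
    using connection.lower_closed[OF galois_connection.axioms(1)[OF g]] y' by (simp add: cone)
  show "z \<in> carrier L \<Longrightarrow> cone y \<sqsubseteq>\<^bsub>L\<^esub> z \<longleftrightarrow> target L R y \<sqsubseteq>\<^bsub>rel_frame L R\<^esub> source L R z"
    using galois_connection.galois_property[OF g] y' by (simp add: cone)
qed

lemma cone_le_iff: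
  assumes "y \<in> carrier L" "z \<in> carrier L"
  shows "cone y \<sqsubseteq>\<^bsub>L\<^esub> z \<longleftrightarrow> (\<top>\<^bsub>L\<^esub> \<otimes> y, z \<otimes> y) \<in> R"
  using assms by (simp add: cone_le_iff_target target_le_source_iff)

lemma cone_unit: "y \<in> carrier L \<Longrightarrow> (\<top>\<^bsub>L\<^esub> \<otimes> y, cone y \<otimes> y) \<in> R"
  using cone_le_iff[of y "cone y"] cone_closed by simp

text \<open>The upper bounds \<open>z\<close> of \<open>cone y\<close> are those with
  \<open>target y\<close> below \<open>source z\<close>, and \<open>target\<close> preserves
  joins.\<close>

lemma conic_frame_cone: "conic_frame L cone"
  unfolding conic_frame_def sup_pres_def
proof (intro conjI allI impI)
  show "cone \<in> carrier L \<rightarrow>\<^sub>E carrier L"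
    using cone_closed by (auto simp: induced_cone_def compose_def)
  fix A assume A: "A \<subseteq> carrier L"
  interpret T: complete_lattice "rel_frame L R"
    by (rule R.complete_lattice_quotient)
  note t_closed = frame_homsD(2)[OF target_frame_homs] and s_closed = frame_homsD(2)[OF source_frame_homs]
  have tA: "target L R ` A \<subseteq> carrier (rel_frame L R)" and cA: "cone ` A \<subseteq> carrier L"
    using A t_closed cone_closed by auto
  show "cone (\<Squnion>\<^bsub>L\<^esub>A) = \<Squnion>\<^bsub>L\<^esub>(cone ` A)"
  proof (rule L.eq_if_same_upper_bounds)
    fix z assume z: "z \<in> carrier L"
    have "cone (\<Squnion>\<^bsub>L\<^esub>A) \<sqsubseteq>\<^bsub>L\<^esub> z \<longleftrightarrow> \<Squnion>\<^bsub>rel_frame L R\<^esub>(target L R ` A) \<sqsubseteq>\<^bsub>rel_frame L R\<^esub> source L R z"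
      using A z by (simp add: cone_le_iff_target frame_homsD(5)[OF target_frame_homs])
    also have "\<dots> \<longleftrightarrow> (\<forall>a\<in>A. target L R a \<sqsubseteq>\<^bsub>rel_frame L R\<^esub> source L R z)"
      by (simp add: T.sup_le_iff[OF tA s_closed[OF z]])
    also have "\<dots> \<longleftrightarrow> (\<forall>a\<in>A. cone a \<sqsubseteq>\<^bsub>L\<^esub> z)"
      using A z by (intro ball_cong refl cone_le_iff_target[symmetric]) auto
    also have "\<dots> \<longleftrightarrow> \<Squnion>\<^bsub>L\<^esub>(cone ` A) \<sqsubseteq>\<^bsub>L\<^esub> z"
      by (simp add: L.sup_le_iff[OF cA z])
    finally show "cone (\<Squnion>\<^bsub>L\<^esub>A) \<sqsubseteq>\<^bsub>L\<^esub> z \<longleftrightarrow> \<Squnion>\<^bsub>L\<^esub>(cone ` A) \<sqsubseteq>\<^bsub>L\<^esub> z" .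
  qed (use A cA in \<open>auto intro: cone_closed\<close>)
qed (rule L.frame_axioms L.complete_lattice)+

text \<open>A smaller congruence is a larger sublocale, so this inclusion makes the identity
  monotone from \<open>R\<close> to the relation induced by its cone.\<close>

lemma induced_relation_cone_subset: "induced_relation L cone \<subseteq> R"
  unfolding induced_relation_def
proof (rule least_frame_congruence_subset[OF congruence_R], clarify)
  fix x y assume xy: "x \<in> carrier L" "y \<in> carrier L"
  \<comment> \<open>\<open>cone_unit\<close> is the generator for \<open>x = \<top>\<close>; meeting
    it with \<open>x \<otimes> \<top>\<close> produces the generator for arbitrary
    \<open>x\<close>.\<close>
  have "(x \<otimes> \<top>\<^bsub>L\<^esub> \<inter> \<top>\<^bsub>L\<^esub> \<otimes> y, x \<otimes> \<top>\<^bsub>L\<^esub> \<inter> cone y \<otimes> y) \<in> R"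
    using R.cong_meet[OF R.cong_refl cone_unit, of "x \<otimes> \<top>\<^bsub>L\<^esub>" y] xy cone_closed
    by (simp add: meet_coprod ideal_rect)
  then show "(x \<otimes> y, (x \<sqinter>\<^bsub>L\<^esub> cone y) \<otimes> y) \<in> R"
    using xy cone_closed L.meet_absorb[of x "\<top>\<^bsub>L\<^esub>"] L.meet_absorb[of y "\<top>\<^bsub>L\<^esub>"]
    by (simp add: rect_Int meet_comm[of L "\<top>\<^bsub>L\<^esub>"])
qed

end

lemma monotone_map_cone:
  assumes "open_localic_relation L R" "open_localic_relation M Q" "monotone_map L R M Q h" "x \<in> carrier M"
  shows "induced_cone L R (h x) \<sqsubseteq>\<^bsub>L\<^esub> h (induced_cone M Q x)"
proof -
  interpret R: open_localic_relation L R by fact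
  interpret Q: open_localic_relation M Q by fact
  have h: "h \<in> frame_homs M L"
    using assms(3) by (simp add: monotone_map_def)
  interpret frame_hom_pair M M L L h h
    by unfold_locales (rule h)+
  have "(H (rect M M \<top>\<^bsub>M\<^esub> x), H (rect M M (Q.cone x) x)) \<in> R"
    using assms(3) Q.cone_unit[OF assms(4)]
    unfolding monotone_map_iff[OF R.localic_relation_axioms Q.localic_relation_axioms] by auto
  \<comment> \<open>\<open>H\<close> sends the two rectangles to \<open>\<top> \<otimes> h x\<close>
    and \<open>h (Q.cone x) \<otimes> h x\<close>; \<open>cone_le_iff\<close> reads this pair as the
    inequality.\<close>
  then show ?thesis
    using assms(4) Q.cone_closed[OF assms(4)] frame_homsD(2,7)[OF h]
    by (simp add: R.cone_le_iff map_rect)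
qed

section \<open>Relations induced by conic frames\<close>

locale conic = L: frame L for L :: "'a gorder" +
  fixes c
  assumes conic: "conic_frame L c"
begin

abbreviation R where "R \<equiv> induced_relation L c"

sublocale frame_pair L L ..

lemma c_closed: "x \<in> carrier L \<Longrightarrow> c x \<in> carrier L"
  and c_extensional: "c \<in> extensional (carrier L)"
  and c_sup: "A \<subseteq> carrier L \<Longrightarrow> c (\<Squnion>\<^bsub>L\<^esub>A) = \<Squnion>\<^bsub>L\<^esub>(c ` A)"
  using conic by (auto simp: conic_frame_def sup_pres_def PiE_iff)

lemma c_mono:
  assumes "x \<in> carrier L" "y \<in> carrier L" "x \<sqsubseteq>\<^bsub>L\<^esub> y"
  shows "c x \<sqsubseteq>\<^bsub>L\<^esub> c y"
proof -
  have "isotone L L c"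
    using conic c_closed
    by (intro join_pres_isotone sup_pres_is_join_pres weak_sup_pres) (auto simp: conic_frame_def)
  then show ?thesis
    using assms by (simp add: use_iso2)
qed

abbreviation generators where
  "generators \<equiv> {(rect L L x y, rect L L (x \<sqinter>\<^bsub>L\<^esub> c y) y) | x y. x \<in> carrier L \<and> y \<in> carrier L}"

lemma generators_closed: "generators \<subseteq> carrier (coprod L L) \<times> carrier (coprod L L)"
  by (auto simp: ideal_rect c_closed)

sublocale localic_relation L R
  unfolding induced_relation_def
  by unfold_locales (rule frame_congruence_least[OF C.complete_lattice generators_closed])

end

context conic
begin

lemma generator: "x \<in> carrier L \<Longrightarrow> y \<in> carrier L \<Longrightarrow> (x \<otimes> y, (x \<sqinter>\<^bsub>L\<^esub> c y) \<otimes> y) \<in> R"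
  unfolding induced_relation_def by (rule subsetD[OF subset_least_frame_congruence]) blast

text \<open>The map \<open>e\<close> is \<open>s\<^sub>!\<close> precomposed with the quotient map. It is left adjoint to \<open>below\<close>.\<close>

definition e where "e u = \<Squnion>\<^bsub>L\<^esub>((\<lambda>(x, y). x \<sqinter>\<^bsub>L\<^esub> c y) ` u)"

abbreviation below where "below z \<equiv> {(x, y) \<in> carrier L \<times> carrier L. x \<sqinter>\<^bsub>L\<^esub> c y \<sqsubseteq>\<^bsub>L\<^esub> z}"

text \<open>Down-closure comes from monotonicity of \<open>c\<close>. Closure in the first variable
  is distributivity; in the second it combines distributivity with preservation of joins by
  \<open>c\<close>.\<close>

lemma ideal_below:
  assumes z: "z \<in> carrier L"
  shows "coprod_ideal L L (below z)"
proof (rule coprod_idealI)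
  fix x y x' y' assume xy: "(x, y) \<in> below z"
    and x': "x' \<in> carrier L" "y' \<in> carrier L" "x' \<sqsubseteq>\<^bsub>L\<^esub> x" "y' \<sqsubseteq>\<^bsub>L\<^esub> y"
  then have "x' \<sqinter>\<^bsub>L\<^esub> c y' \<sqsubseteq>\<^bsub>L\<^esub> x \<sqinter>\<^bsub>L\<^esub> c y"
    by (intro L.meet_mono) (auto simp: c_closed c_mono)
  then have "x' \<sqinter>\<^bsub>L\<^esub> c y' \<sqsubseteq>\<^bsub>L\<^esub> z"
    by (rule L.le_trans) (use xy x' z in \<open>auto simp: c_closed\<close>)
  then show "(x', y') \<in> below z"
    using x' by simp
next
  fix A y assume A: "A \<subseteq> carrier L" and y: "y \<in> carrier L" and le: "\<And>a. a \<in> A \<Longrightarrow> (a, y) \<in> below z"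
  have "\<Squnion>\<^bsub>L\<^esub>((\<lambda>a. a \<sqinter>\<^bsub>L\<^esub> c y) ` A) \<sqsubseteq>\<^bsub>L\<^esub> z"
    using A y z le by (intro L.sup_least) (auto simp: c_closed)
  then show "(\<Squnion>\<^bsub>L\<^esub>A, y) \<in> below z"
    using A y by (simp add: L.meet_Sup_distrib' c_closed)
next
  fix x B assume x: "x \<in> carrier L" and B: "B \<subseteq> carrier L" and le: "\<And>b. b \<in> B \<Longrightarrow> (x, b) \<in> below z"
  have cB: "c ` B \<subseteq> carrier L"
    using B by (auto simp: c_closed)
  have "\<Squnion>\<^bsub>L\<^esub>((\<lambda>b. x \<sqinter>\<^bsub>L\<^esub> c b) ` B) \<sqsubseteq>\<^bsub>L\<^esub> z"
    using B x z le by (intro L.sup_least) (auto simp: c_closed)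
  then show "(x, \<Squnion>\<^bsub>L\<^esub>B) \<in> below z"
    using B x by (simp add: L.meet_Sup_distrib[OF x cB] c_sup image_image)
qed auto

lemma e_terms_closed:
  assumes "u \<subseteq> carrier L \<times> carrier L"
  shows "(\<lambda>(x, y). x \<sqinter>\<^bsub>L\<^esub> c y) ` u \<subseteq> carrier L"
  using assms by (auto simp: c_closed)

lemma e_closed: "coprod_ideal L L u \<Longrightarrow> e u \<in> carrier L"
  unfolding e_def using e_terms_closed coprod_idealD(1) by (intro L.sup_closed) blast

lemma e_le_iff:
  assumes u: "coprod_ideal L L u" and z: "z \<in> carrier L"
  shows "e u \<sqsubseteq>\<^bsub>L\<^esub> z \<longleftrightarrow> u \<subseteq> below z"
proof -
  have "e u \<sqsubseteq>\<^bsub>L\<^esub> z \<longleftrightarrow> (\<forall>(x, y)\<in>u. x \<sqinter>\<^bsub>L\<^esub> c y \<sqsubseteq>\<^bsub>L\<^esub> z)"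
    unfolding e_def using coprod_idealD(1)[OF u]
    by (subst L.sup_le_iff[OF e_terms_closed z]) auto
  also have "\<dots> \<longleftrightarrow> u \<subseteq> below z"
    using coprod_idealD(1)[OF u] by blast
  finally show ?thesis .
qed

lemma e_sup:
  assumes U: "U \<subseteq> carrier (coprod L L)"
  shows "e (\<Squnion>\<^bsub>coprod L L\<^esub>U) = \<Squnion>\<^bsub>L\<^esub>(e ` U)"
proof (rule L.eq_if_same_upper_bounds)
  have eU: "e ` U \<subseteq> carrier L"
    using U by (auto intro!: e_closed)
  then show "\<Squnion>\<^bsub>L\<^esub>(e ` U) \<in> carrier L"
    by simp
  show "e (\<Squnion>\<^bsub>coprod L L\<^esub>U) \<in> carrier L"
    by (intro e_closed ideal_sup_coprod U)
  fix z assume z: "z \<in> carrier L"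
  have "e (\<Squnion>\<^bsub>coprod L L\<^esub>U) \<sqsubseteq>\<^bsub>L\<^esub> z \<longleftrightarrow> (\<forall>u\<in>U. u \<subseteq> below z)"
    unfolding e_le_iff[OF ideal_sup_coprod[OF U] z] by (rule sup_coprod_le_iff[OF U ideal_below[OF z]])
  also have "\<dots> \<longleftrightarrow> (\<forall>u\<in>U. e u \<sqsubseteq>\<^bsub>L\<^esub> z)"
    using U z by (intro ball_cong refl e_le_iff[symmetric]) auto
  also have "\<dots> \<longleftrightarrow> \<Squnion>\<^bsub>L\<^esub>(e ` U) \<sqsubseteq>\<^bsub>L\<^esub> z"
    by (simp add: L.sup_le_iff[OF eU z])
  finally show "e (\<Squnion>\<^bsub>coprod L L\<^esub>U) \<sqsubseteq>\<^bsub>L\<^esub> z \<longleftrightarrow> \<Squnion>\<^bsub>L\<^esub>(e ` U) \<sqsubseteq>\<^bsub>L\<^esub> z" .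
qed

lemma e_mono:
  assumes "coprod_ideal L L u" "coprod_ideal L L v" "u \<subseteq> v"
  shows "e u \<sqsubseteq>\<^bsub>L\<^esub> e v"
  using assms e_le_iff[of v "e v"] e_le_iff[of u "e v"] e_closed by auto

text \<open>The first rectangle contains the second, so the work is to bound the pairs of the larger
  one: each can be replaced by a smaller pair, inside the smaller rectangle, that gives the same
  value.\<close>

lemma e_generator:
  assumes x: "x \<in> carrier L" and y: "y \<in> carrier L" and w: "coprod_ideal L L w"
  shows "e (x \<otimes> y \<inter> w) = e ((x \<sqinter>\<^bsub>L\<^esub> c y) \<otimes> y \<inter> w)"
proof (rule L.eq_if_same_upper_bounds)
  have ideals: "coprod_ideal L L (x \<otimes> y \<inter> w)" "coprod_ideal L L ((x \<sqinter>\<^bsub>L\<^esub> c y) \<otimes> y \<inter> w)"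
    using x y w by (auto intro!: ideal_Int ideal_rect simp: c_closed)
  then show "e (x \<otimes> y \<inter> w) \<in> carrier L" "e ((x \<sqinter>\<^bsub>L\<^esub> c y) \<otimes> y \<inter> w) \<in> carrier L"
    by (auto intro: e_closed)
  fix z assume z: "z \<in> carrier L"
  have "x \<otimes> y \<inter> w \<subseteq> below z" if le: "(x \<sqinter>\<^bsub>L\<^esub> c y) \<otimes> y \<inter> w \<subseteq> below z"
  proof (rule subsetI, unfold split_paired_all)
    fix p q assume "(p, q) \<in> x \<otimes> y \<inter> w"
    then have p: "(p, q) \<in> x \<otimes> y" and pw: "(p, q) \<in> w"
      by auto
    show "(p, q) \<in> below z"
    \<comment> \<open>Degenerate pairs need not lie under the corner, but every ideal contains
      them.\<close>
    proof (cases "p = \<bottom>\<^bsub>L\<^esub> \<or> q = \<bottom>\<^bsub>L\<^esub>")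
      case True
      then show ?thesis
        using ideal_bottom[OF ideal_below[OF z]] p x y by (auto simp: rect_eq simp del: mem_Collect_eq)
    next
      case False
      then have pq: "p \<in> carrier L" "q \<in> carrier L" "p \<sqsubseteq>\<^bsub>L\<^esub> x" "q \<sqsubseteq>\<^bsub>L\<^esub> y"
        using p x y by (auto simp: rect_eq)
      \<comment> \<open>The pair \<open>(p, q)\<close> is shrunk to
        \<open>(p \<sqinter> c q, q)\<close>: it lies in the smaller rectangle because
        \<open>c q \<sqsubseteq> c y\<close>, it stays in \<open>w\<close> by down-closure, and
        idempotence of the meet preserves its value \<open>p \<sqinter> c q\<close>.\<close>
      have "(p \<sqinter>\<^bsub>L\<^esub> c q, q) \<in> (x \<sqinter>\<^bsub>L\<^esub> c y) \<otimes> y"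
        using pq x y by (simp add: rect_eq c_closed L.meet_mono c_mono)
      moreover have "(p \<sqinter>\<^bsub>L\<^esub> c q, q) \<in> w"
        using pq by (intro coprod_idealD(2)[OF w pw]) (auto simp: c_closed L.meet_left)
      ultimately have "p \<sqinter>\<^bsub>L\<^esub> c q \<sqinter>\<^bsub>L\<^esub> c q \<sqsubseteq>\<^bsub>L\<^esub> z"
        using le by auto
      then show ?thesis
        using pq by (simp add: L.meet_assoc c_closed L.meet_absorb)
    qed
  qed
  moreover have "(x \<sqinter>\<^bsub>L\<^esub> c y) \<otimes> y \<subseteq> x \<otimes> y"
    using x y by (intro rect_mono) (auto simp: c_closed L.meet_left)
  ultimately show "e (x \<otimes> y \<inter> w) \<sqsubseteq>\<^bsub>L\<^esub> z \<longleftrightarrow> e ((x \<sqinter>\<^bsub>L\<^esub> c y) \<otimes> y \<inter> w) \<sqsubseteq>\<^bsub>L\<^esub> z"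
    unfolding e_le_iff[OF ideals(1) z] e_le_iff[OF ideals(2) z] by blast
qed

lemma e_cong_Int:
  assumes uv: "(u, v) \<in> R" and w: "coprod_ideal L L w"
  shows "e (u \<inter> w) = e (v \<inter> w)"
proof -
  let ?T = "{(u, v) \<in> carrier (coprod L L) \<times> carrier (coprod L L).
    \<forall>w\<in>carrier (coprod L L). e (u \<sqinter>\<^bsub>coprod L L\<^esub> w) = e (v \<sqinter>\<^bsub>coprod L L\<^esub> w)}"
  have "frame_congruence (coprod L L) ?T"
    by (rule kernel_congruence[OF frame_coprod e_sup])
  moreover have "generators \<subseteq> ?T"
  proof (rule subsetI, elim CollectE exE conjE, hypsubst)
    fix x y assume xy: "x \<in> carrier L" "y \<in> carrier L"
    then have ideals: "coprod_ideal L L (x \<otimes> y)" "coprod_ideal L L ((x \<sqinter>\<^bsub>L\<^esub> c y) \<otimes> y)"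
      by (auto intro!: ideal_rect simp: c_closed)
    then show "(x \<otimes> y, (x \<sqinter>\<^bsub>L\<^esub> c y) \<otimes> y) \<in> ?T"
      using e_generator[OF xy] by (simp add: meet_coprod)
  qed
  ultimately have "R \<subseteq> ?T"
    unfolding induced_relation_def by (rule least_frame_congruence_subset)
  then have "(u, v) \<in> ?T"
    using uv by blast
  then show ?thesis
    using w meet_coprod[of u w] meet_coprod[of v w] by auto
qed

lemma e_cong:
  assumes "(u, v) \<in> R"
  shows "e u = e v"
  using e_cong_Int[OF assms ideal_full] coprod_idealD(1)[of L L] R.cong_carrier[OF assms]
  by (simp add: Int_absorb2)

text \<open>Through \<open>e_le_iff\<close>, this bounds by \<open>z\<close> the value of
  \<open>e\<close> at every ideal inside \<open>z \<otimes> \<top>\<close>.\<close>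

lemma e_rect_top_le:
  assumes "z \<in> carrier L"
  shows "z \<otimes> \<top>\<^bsub>L\<^esub> \<subseteq> below z"
  unfolding rect_le_iff[OF ideal_below[OF assms]] using assms by (simp add: c_closed L.meet_left)

text \<open>Forwards, \<open>e\<close> respects \<open>R\<close> and has values below
  \<open>z\<close> on ideals inside \<open>z \<otimes> \<top>\<close>. Backwards, \<open>u\<close>
  is split into rectangles \<open>x \<otimes> y\<close>; the generator replaces each by
  \<open>(x \<sqinter> c y) \<otimes> y\<close>, which lies inside
  \<open>z \<otimes> \<top>\<close>.\<close>

lemma q_le_source_iff_e:
  assumes u: "coprod_ideal L L u" and z: "z \<in> carrier L"
  shows "R.q u \<sqsubseteq>\<^bsub>rel_frame L R\<^esub> source L R z \<longleftrightarrow> e u \<sqsubseteq>\<^bsub>L\<^esub> z"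
proof
  assume "R.q u \<sqsubseteq>\<^bsub>rel_frame L R\<^esub> source L R z"
  then have "e u = e (u \<inter> z \<otimes> \<top>\<^bsub>L\<^esub>)"
    unfolding q_le_source_iff[OF u z] by (rule e_cong)
  also have "\<dots> \<sqsubseteq>\<^bsub>L\<^esub> z"
    using e_rect_top_le[OF z] e_le_iff[of "u \<inter> z \<otimes> \<top>\<^bsub>L\<^esub>", OF _ z] u z
    by (meson L.top_closed ideal_Int ideal_rect le_infI2)
  finally show "e u \<sqsubseteq>\<^bsub>L\<^esub> z" .
next
  assume e: "e u \<sqsubseteq>\<^bsub>L\<^esub> z"
  interpret Q: complete_lattice "rel_frame L R"
    by (rule R.complete_lattice_quotient)
  have rects: "(\<lambda>(x, y). x \<otimes> y) ` u \<subseteq> carrier (coprod L L)"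
    using coprod_idealD(1)[OF u] by (auto intro!: ideal_rect)
  have sz: "source L R z \<in> carrier (rel_frame L R)"
    by (rule frame_homsD(2)[OF source_frame_homs z])
  have "R.q u = \<Squnion>\<^bsub>rel_frame L R\<^esub>(R.q ` (\<lambda>(x, y). x \<otimes> y) ` u)"
    unfolding frame_homsD(5)[OF R.q_frame_homs rects, symmetric] sup_rects[OF u] ..
  also have "\<dots> \<sqsubseteq>\<^bsub>rel_frame L R\<^esub> source L R z"
  proof (rule Q.sup_least)
    show "R.q ` (\<lambda>(x, y). x \<otimes> y) ` u \<subseteq> carrier (rel_frame L R)"
      using rects R.q_closed by blast
    fix A assume "A \<in> R.q ` (\<lambda>(x, y). x \<otimes> y) ` u"
    then obtain x y where A: "A = R.q (x \<otimes> y)" and xy: "(x, y) \<in> u"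
      by auto
    then have le: "x \<sqinter>\<^bsub>L\<^esub> c y \<sqsubseteq>\<^bsub>L\<^esub> z" and carr: "x \<in> carrier L" "y \<in> carrier L"
      using e coprod_idealD(1)[OF u] unfolding e_le_iff[OF u z] by auto
    have "A = R.q ((x \<sqinter>\<^bsub>L\<^esub> c y) \<otimes> y)"
      using carr generator[OF carr] by (simp add: A R.q_eq_iff ideal_rect c_closed)
    also have "\<dots> \<sqsubseteq>\<^bsub>rel_frame L R\<^esub> source L R z"
      using carr z le rect_mono[of "x \<sqinter>\<^bsub>L\<^esub> c y" y z "\<top>\<^bsub>L\<^esub>"]
      by (simp add: source_def R.q_mono ideal_rect c_closed)
    finally show "A \<sqsubseteq>\<^bsub>rel_frame L R\<^esub> source L R z" .
  qed (rule sz)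
  finally show "R.q u \<sqsubseteq>\<^bsub>rel_frame L R\<^esub> source L R z" .
qed

text \<open>The inequality from right to left distributes \<open>v\<close> over the join defining
  \<open>e u\<close>: for \<open>(x, y)\<close> in \<open>u\<close>, the pair
  \<open>(v \<sqinter> x, y)\<close> lies both in \<open>u\<close> and in
  \<open>v \<otimes> \<top>\<close>.\<close>

lemma e_frobenius:
  assumes u: "coprod_ideal L L u" and v: "v \<in> carrier L"
  shows "e (u \<inter> v \<otimes> \<top>\<^bsub>L\<^esub>) = e u \<sqinter>\<^bsub>L\<^esub> v"
proof (rule L.le_antisym)
  have ideal: "coprod_ideal L L (u \<inter> v \<otimes> \<top>\<^bsub>L\<^esub>)"
    using u v by (intro ideal_Int ideal_rect) auto
  show carr: "e (u \<inter> v \<otimes> \<top>\<^bsub>L\<^esub>) \<in> carrier L" "e u \<sqinter>\<^bsub>L\<^esub> v \<in> carrier L"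
    using u v ideal by (auto simp: e_closed)
  have "e (u \<inter> v \<otimes> \<top>\<^bsub>L\<^esub>) \<sqsubseteq>\<^bsub>L\<^esub> v"
    using e_rect_top_le[OF v] unfolding e_le_iff[OF ideal v] by blast
  then show "e (u \<inter> v \<otimes> \<top>\<^bsub>L\<^esub>) \<sqsubseteq>\<^bsub>L\<^esub> e u \<sqinter>\<^bsub>L\<^esub> v"
    using u v carr e_mono[OF ideal u] by (simp add: L.le_meet_iff e_closed)
  have "v \<sqinter>\<^bsub>L\<^esub> (x \<sqinter>\<^bsub>L\<^esub> c y) \<sqsubseteq>\<^bsub>L\<^esub> e (u \<inter> v \<otimes> \<top>\<^bsub>L\<^esub>)" if xy: "(x, y) \<in> u" for x y
  proof -
    have xy': "x \<in> carrier L" "y \<in> carrier L"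
      using xy coprod_idealD(1)[OF u] by auto
    have "(v \<sqinter>\<^bsub>L\<^esub> x, y) \<in> u \<inter> v \<otimes> \<top>\<^bsub>L\<^esub>"
      using xy' v coprod_idealD(2)[OF u xy] by (simp add: rect_eq L.meet_left L.meet_right)
    then have "(v \<sqinter>\<^bsub>L\<^esub> x) \<sqinter>\<^bsub>L\<^esub> c y \<sqsubseteq>\<^bsub>L\<^esub> e (u \<inter> v \<otimes> \<top>\<^bsub>L\<^esub>)"
      using e_le_iff[OF ideal carr(1)] carr(1) by auto
    then show ?thesis
      using xy' v by (simp add: L.meet_assoc c_closed)
  qed
  then have "\<Squnion>\<^bsub>L\<^esub>((\<lambda>a. v \<sqinter>\<^bsub>L\<^esub> a) ` (\<lambda>(x, y). x \<sqinter>\<^bsub>L\<^esub> c y) ` u) \<sqsubseteq>\<^bsub>L\<^esub> e (u \<inter> v \<otimes> \<top>\<^bsub>L\<^esub>)"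
    using coprod_idealD(1)[OF u] v carr(1) by (intro L.sup_least) (auto simp: c_closed)
  then show "e u \<sqinter>\<^bsub>L\<^esub> v \<sqsubseteq>\<^bsub>L\<^esub> e (u \<inter> v \<otimes> \<top>\<^bsub>L\<^esub>)"
    unfolding e_def[of u] meet_comm[of L _ v]
    by (simp only: L.meet_Sup_distrib[OF v e_terms_closed[OF coprod_idealD(1)[OF u]]])
qed

lemma open_source_induced: "open_source L R"
proof -
  \<comment> \<open>By \<open>e_cong\<close>, \<open>e\<close> is constant on classes, so
    \<open>g\<close> is the descent of \<open>e\<close> to the quotient and the candidate for the
    lower adjoint of the source.\<close>
  define g where "g = (\<lambda>A. the_elem (e ` A))"
  have g: "g (R.q u) = e u" if u: "coprod_ideal L L u" for u
  proof -
    have "e v = e u" if "v \<in> R.q u" for v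
      using that u e_cong[of u v] by (simp add: quot_map_def)
    moreover have "u \<in> R.q u"
      using u R.cong_refl[of u] by (simp add: quot_map_def)
    ultimately have "e ` R.q u = {e u}"
      by blast
    then show ?thesis
      by (simp add: g_def)
  qed
  have rep: "\<exists>u. coprod_ideal L L u \<and> A = R.q u" if "A \<in> carrier (rel_frame L R)" for A
    using that by (auto simp: R.carrier_quotient)
  have "galois_connection \<lparr>orderA = rel_frame L R, orderB = L, lower = g, upper = source L R\<rparr>"
    unfolding galois_connection_def connection_def galois_connection_axioms_def galcon.simps
  proof (intro conjI allI impI)
    show "g \<in> carrier (rel_frame L R) \<rightarrow> carrier L"
      using rep g e_closed by fastforce
    show "source L R \<in> carrier L \<rightarrow> carrier (rel_frame L R)"
      using frame_homsD(2)[OF source_frame_homs] by simp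
    show "g A \<sqsubseteq>\<^bsub>L\<^esub> z \<longleftrightarrow> A \<sqsubseteq>\<^bsub>rel_frame L R\<^esub> source L R z"
      if "A \<in> carrier (rel_frame L R)" "z \<in> carrier L" for A z
      using rep[OF that(1)] that(2) g q_le_source_iff_e by auto
  qed (rule R.partial_order_quotient L.partial_order_axioms)+
  moreover have "g (A \<sqinter>\<^bsub>rel_frame L R\<^esub> source L R v) = g A \<sqinter>\<^bsub>L\<^esub> v"
    if A: "A \<in> carrier (rel_frame L R)" and v: "v \<in> carrier L" for A v
  proof -
    obtain u where u: "coprod_ideal L L u" "A = R.q u"
      using rep[OF A] by blast
    have ideal: "coprod_ideal L L (v \<otimes> \<top>\<^bsub>L\<^esub>)"
      using v by (intro ideal_rect) auto
    have "A \<sqinter>\<^bsub>rel_frame L R\<^esub> source L R v = R.q (u \<inter> v \<otimes> \<top>\<^bsub>L\<^esub>)"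
      using frame_homsD(6)[OF R.q_frame_homs, of u "v \<otimes> \<top>\<^bsub>L\<^esub>"] u ideal v
      by (simp add: source_def meet_coprod)
    then show ?thesis
      using u v ideal by (simp add: g ideal_Int e_frobenius)
  qed
  ultimately show ?thesis
    unfolding open_source_def open_locale_map_def using source_frame_homs by blast
qed

sublocale open_localic_relation L R
  by unfold_locales (rule open_source_induced)

text \<open>Both functions are extensional, so agreement on the carrier gives equality. This strict
  equality is what allows the counit to be an identity and not merely an isomorphism.\<close>

lemma cone_induced_relation: "induced_cone L R = c"
proof (rule extensionalityI[of _ "carrier L"])
  fix y assume y: "y \<in> carrier L"
  have ideal: "coprod_ideal L L (\<top>\<^bsub>L\<^esub> \<otimes> y)"
    using y by (intro ideal_rect) auto
  show "induced_cone L R y = c y"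
  proof (rule L.eq_if_same_upper_bounds)
    fix z assume z: "z \<in> carrier L"
    have "induced_cone L R y \<sqsubseteq>\<^bsub>L\<^esub> z \<longleftrightarrow> e (\<top>\<^bsub>L\<^esub> \<otimes> y) \<sqsubseteq>\<^bsub>L\<^esub> z"
      using q_le_source_iff_e[OF ideal z] y z by (simp add: cone_le_iff_target target_def)
    also have "\<dots> \<longleftrightarrow> \<top>\<^bsub>L\<^esub> \<otimes> y \<subseteq> below z"
      by (rule e_le_iff[OF ideal z])
    also have "\<dots> \<longleftrightarrow> (\<top>\<^bsub>L\<^esub>, y) \<in> below z"
      by (rule rect_le_iff[OF ideal_below[OF z]])
    also have "\<dots> \<longleftrightarrow> c y \<sqsubseteq>\<^bsub>L\<^esub> z"
      using y L.meet_absorb[of "c y" "\<top>\<^bsub>L\<^esub>"] by (simp add: c_closed meet_comm[of L "\<top>\<^bsub>L\<^esub>"])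
    finally show "induced_cone L R y \<sqsubseteq>\<^bsub>L\<^esub> z \<longleftrightarrow> c y \<sqsubseteq>\<^bsub>L\<^esub> z" .
  qed (use y in \<open>auto simp: cone_closed c_closed\<close>)
qed (auto simp: c_extensional induced_cone_def)

end

lemma conicI: "conic_frame L c \<Longrightarrow> conic L c"
  by (simp add: conic_def conic_axioms_def conic_frame_def)

lemma monotone_map_induced:
  assumes L: "conic_frame L c" and M: "conic_frame M d"
    and h: "h \<in> frame_homs L M" and lax: "\<And>x. x \<in> carrier L \<Longrightarrow> d (h x) \<sqsubseteq>\<^bsub>M\<^esub> h (c x)"
  shows "monotone_map M (induced_relation M d) L (induced_relation L c) h"
proof -
  interpret c: conic L c by (rule conicI[OF L])
  interpret d: conic M d by (rule conicI[OF M])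
  interpret frame_hom_pair L L M M h h
    by unfold_locales (rule h)+
  let ?T = "{(u, v) \<in> carrier (coprod L L) \<times> carrier (coprod L L). (H u, H v) \<in> d.R}"
  have "c.generators \<subseteq> ?T"
  proof (rule subsetI, elim CollectE exE conjE, hypsubst)
    fix x y assume xy: "x \<in> carrier L" "y \<in> carrier L"
    note h_closed = frame_homsD(2)[OF h]
    have hxy: "h x \<in> carrier M" "h y \<in> carrier M" "h (c y) \<in> carrier M" "d (h y) \<in> carrier M"
      using xy by (auto simp: h_closed c.c_closed d.c_closed)
    \<comment> \<open>Laxness squeezes \<open>?mid\<close> between \<open>?small\<close> and
      \<open>?big\<close>, the two sides of a generator of \<open>d.R\<close>. Convexity then
      identifies \<open>?big\<close> with \<open>?mid\<close>, the image of the generator for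
      \<open>x\<close> and \<open>y\<close>.\<close>
    let ?small = "rect M M (h x \<sqinter>\<^bsub>M\<^esub> d (h y)) (h y)"
    let ?mid = "rect M M (h x \<sqinter>\<^bsub>M\<^esub> h (c y)) (h y)"
    let ?big = "rect M M (h x) (h y)"
    have "?small \<subseteq> ?mid" "?mid \<subseteq> ?big"
      using hxy lax[OF xy(2)] by (intro d.rect_mono d.L.meet_mono d.L.meet_left; simp)+
    moreover have sb: "(?small, ?big) \<in> d.R"
      using d.generator[OF hxy(1,2)] by (rule d.R.cong_sym)
    ultimately have "(?small, ?mid) \<in> d.R"
      using hxy by (intro d.R.cong_convex[OF sb]) (auto simp: d.ideal_rect)
    then have "(?big, ?mid) \<in> d.R"
      using d.R.cong_trans[OF d.R.cong_sym[OF sb]] by blast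
    show "(rect L L x y, rect L L (x \<sqinter>\<^bsub>L\<^esub> c y) y) \<in> ?T"
      using \<open>(?big, ?mid) \<in> d.R\<close> xy
      by (simp add: map_rect c.c_closed c.ideal_rect frame_homsD(6)[OF h])
  qed
  then have "c.R \<subseteq> ?T"
    unfolding induced_relation_def[of L c]
    by (rule least_frame_congruence_subset[OF frame_congruence_vimage[OF map_frame_homs d.congruence_R]])
  then show ?thesis
    unfolding monotone_map_iff[OF d.localic_relation_axioms c.localic_relation_axioms]
    using h by blast
qed

section \<open>The two categories\<close>

lemma frame_homs_PiE: "h \<in> frame_homs L M \<Longrightarrow> h \<in> carrier L \<rightarrow> carrier M"
  "h \<in> frame_homs L M \<Longrightarrow> h \<in> extensional (carrier L)"
  using frame_homsD(1)[of h L M] by (auto simp: PiE_def)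

lemma frame_homs_compose_id:
  assumes "h \<in> frame_homs L M"
  shows "compose (carrier L) h (\<lambda>x\<in>carrier L. x) = h" "compose (carrier L) (\<lambda>x\<in>carrier M. x) h = h"
  using frame_homs_PiE[OF assms] by (auto intro: compose_Id Id_compose)

lemma monotone_map_id:
  assumes "localic_relation L R" "localic_relation L Q" "Q \<subseteq> R"
  shows "monotone_map L R L Q (\<lambda>x\<in>carrier L. x)"
proof -
  interpret localic_relation L R by fact
  interpret Q: localic_relation L Q by fact
  have "(coprod_map L L L L (\<lambda>x\<in>carrier L. x) (\<lambda>x\<in>carrier L. x) u,
      coprod_map L L L L (\<lambda>x\<in>carrier L. x) (\<lambda>x\<in>carrier L. x) v) \<in> R" if uv: "(u, v) \<in> Q" for u v
    using Q.R.cong_carrier[OF uv] uv assms(3)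
    by (auto simp: coprod_map_id[OF L.frame_axioms L.frame_axioms])
  then show ?thesis
    unfolding monotone_map_iff[OF assms(1,2)] using id_frame_homs[OF L.complete_lattice] by blast
qed

lemma monotone_map_compose:
  assumes "localic_relation L R" "localic_relation M Q" "localic_relation N P"
    and f: "monotone_map L R M Q f" and g: "monotone_map M Q N P g"
  shows "monotone_map L R N P (compose (carrier N) f g)"
proof -
  interpret R: localic_relation L R by fact
  interpret Q: localic_relation M Q by fact
  interpret P: localic_relation N P by fact
  have homs: "f \<in> frame_homs M L" "g \<in> frame_homs N M"
    using f g by (auto simp: monotone_map_def)
  have comp: "coprod_map N N L L (compose (carrier N) f g) (compose (carrier N) f g) u =
      coprod_map M M L L f f (coprod_map N N M M g g u)" if "coprod_ideal N N u" for u
    by (rule coprod_map_compose) (use homs that in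
        \<open>auto intro: R.L.frame_axioms Q.L.frame_axioms P.L.frame_axioms\<close>)
  have "(coprod_map M M L L f f (coprod_map N N M M g g u),
      coprod_map M M L L f f (coprod_map N N M M g g v)) \<in> R" if "(u, v) \<in> P" for u v
    using f g that unfolding monotone_map_iff[OF assms(1,2)] monotone_map_iff[OF assms(2,3)] by blast
  then have "(coprod_map N N L L (compose (carrier N) f g) (compose (carrier N) f g) u,
      coprod_map N N L L (compose (carrier N) f g) (compose (carrier N) f g) v) \<in> R" if "(u, v) \<in> P" for u v
    using P.R.cong_carrier[OF that] that by (simp add: comp)
  then show ?thesis
    unfolding monotone_map_iff[OF assms(1,3)] using compose_frame_homs[OF homs] by blast
qed

lemma rosLoc_simps:
  "A \<in> Obj rosLoc \<longleftrightarrow> open_localic_relation (fst A) (snd A)"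
  "f \<in> Hom rosLoc A B \<longleftrightarrow> monotone_map (fst A) (snd A) (fst B) (snd B) f"
  "Ident rosLoc A = (\<lambda>x\<in>carrier (fst A). x)"
  "Comp rosLoc A B D g f = compose (carrier (fst D)) f g"
  by (auto simp: rosLoc_def split_beta open_localic_relation_def localic_relation_def
      localic_relation_axioms_def open_localic_relation_axioms_def)

lemma conicFrm_simps:
  "A \<in> Obj conicFrm \<longleftrightarrow> conic_frame (fst A) (snd A)"
  "f \<in> Hom conicFrm A B \<longleftrightarrow> f \<in> frame_homs (fst A) (fst B) \<and>
    (\<forall>x\<in>carrier (fst A). snd B (f x) \<sqsubseteq>\<^bsub>fst B\<^esub> f (snd A x))"
  "Ident conicFrm A = (\<lambda>x\<in>carrier (fst A). x)"
  "Comp conicFrm A B D g f = compose (carrier (fst A)) g f"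
  by (auto simp: conicFrm_def split_beta)

lemma opposite_simps:
  "Obj (opposite K) = Obj K" "Hom (opposite K) A B = Hom K B A" "Ident (opposite K) = Ident K"
  "Comp (opposite K) A B D g f = Comp K D B A f g"
  by (simp_all add: opposite_def)

lemma is_category_opposite:
  assumes "is_category K"
  shows "is_category (opposite K)"
  using assms unfolding is_category_def opposite_simps by (intro conjI ballI) simp_all

lemma rosLoc_localic: "A \<in> Obj rosLoc \<Longrightarrow> localic_relation (fst A) (snd A)"
  by (simp add: rosLoc_simps open_localic_relation_def)

lemma rosLoc_homs: "f \<in> Hom rosLoc A B \<Longrightarrow> f \<in> frame_homs (fst B) (fst A)"
  by (simp add: rosLoc_simps monotone_map_def)

lemma is_category_rosLoc: "is_category rosLoc"
  unfolding is_category_def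
proof (intro conjI ballI)
  fix A :: "'a gorder \<times> 'a lrel" assume "A \<in> Obj rosLoc"
  then show "Ident rosLoc A \<in> Hom rosLoc A A"
    using monotone_map_id[OF rosLoc_localic rosLoc_localic subset_refl] by (simp add: rosLoc_simps(2,3))
next
  fix A B D :: "'a gorder \<times> 'a lrel" and f g
  assume "A \<in> Obj rosLoc" "B \<in> Obj rosLoc" "D \<in> Obj rosLoc" "f \<in> Hom rosLoc A B" "g \<in> Hom rosLoc B D"
  then show "Comp rosLoc A B D g f \<in> Hom rosLoc A D"
    using monotone_map_compose[OF rosLoc_localic rosLoc_localic rosLoc_localic]
    by (simp add: rosLoc_simps(2,4))
next
  fix A B :: "'a gorder \<times> 'a lrel" and f assume "f \<in> Hom rosLoc A B"
  then show "Comp rosLoc A A B f (Ident rosLoc A) = f" "Comp rosLoc A B B (Ident rosLoc B) f = f"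
    by (simp_all add: rosLoc_simps(3,4) frame_homs_compose_id[OF rosLoc_homs])
next
  fix A B D E :: "'a gorder \<times> 'a lrel" and f g h
  assume "h \<in> Hom rosLoc D E" "g \<in> Hom rosLoc B D"
  then show "Comp rosLoc A D E h (Comp rosLoc A B D g f) = Comp rosLoc A B E (Comp rosLoc B D E h g) f"
    using compose_assoc[OF frame_homs_PiE(1)[OF rosLoc_homs], of h D E f g] by (simp add: rosLoc_simps(4))
qed

lemma is_category_conicFrm: "is_category conicFrm"
  unfolding is_category_def
proof (intro conjI ballI)
  fix A :: "'a gorder \<times> ('a \<Rightarrow> 'a)" assume "A \<in> Obj conicFrm"
  then interpret conic "fst A" "snd A"
    by (intro conicI) (simp add: conicFrm_simps)
  show "Ident conicFrm A \<in> Hom conicFrm A A"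
    by (simp add: conicFrm_simps id_frame_homs[OF L.complete_lattice] c_closed)
next
  fix A B D :: "'a gorder \<times> ('a \<Rightarrow> 'a)" and f g
  assume A: "A \<in> Obj conicFrm" and B: "B \<in> Obj conicFrm" and D: "D \<in> Obj conicFrm"
    and f: "f \<in> Hom conicFrm A B" and g: "g \<in> Hom conicFrm B D"
  interpret A: conic "fst A" "snd A" using A by (intro conicI) (simp add: conicFrm_simps)
  interpret B: conic "fst B" "snd B" using B by (intro conicI) (simp add: conicFrm_simps)
  interpret D: conic "fst D" "snd D" using D by (intro conicI) (simp add: conicFrm_simps)
  have homs: "f \<in> frame_homs (fst A) (fst B)" "g \<in> frame_homs (fst B) (fst D)"
    using f g by (auto simp: conicFrm_simps)
  note closed = frame_homsD(2)[OF homs(1)] frame_homsD(2)[OF homs(2)]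
  have "snd D (g (f x)) \<sqsubseteq>\<^bsub>fst D\<^esub> g (f (snd A x))" if x: "x \<in> carrier (fst A)" for x
  proof (rule D.L.le_trans)
    show "snd D (g (f x)) \<sqsubseteq>\<^bsub>fst D\<^esub> g (snd B (f x))"
      using g closed x by (simp add: conicFrm_simps)
    show "g (snd B (f x)) \<sqsubseteq>\<^bsub>fst D\<^esub> g (f (snd A x))"
      using f closed x A.c_closed B.c_closed by (intro frame_homs_mono[OF homs(2)]) (auto simp: conicFrm_simps)
  qed (use x closed A.c_closed B.c_closed D.c_closed in auto)
  then show "Comp conicFrm A B D g f \<in> Hom conicFrm A D"
    using compose_frame_homs[OF homs(2,1)] A.c_closed by (simp add: conicFrm_simps compose_def)
next
  fix A B :: "'a gorder \<times> ('a \<Rightarrow> 'a)" and f assume "f \<in> Hom conicFrm A B"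
  then have "f \<in> frame_homs (fst A) (fst B)"
    by (simp add: conicFrm_simps)
  then show "Comp conicFrm A A B f (Ident conicFrm A) = f" "Comp conicFrm A B B (Ident conicFrm B) f = f"
    by (simp_all add: conicFrm_simps(3,4) frame_homs_compose_id)
next
  fix A B D E :: "'a gorder \<times> ('a \<Rightarrow> 'a)" and f g h
  assume "f \<in> Hom conicFrm A B"
  then have "f \<in> carrier (fst A) \<rightarrow> carrier (fst B)"
    by (intro frame_homs_PiE) (simp add: conicFrm_simps)
  from compose_assoc[OF this]
  show "Comp conicFrm A D E h (Comp conicFrm A B D g f) = Comp conicFrm A B E (Comp conicFrm B D E h g) f"
    by (simp add: conicFrm_simps(4))
qed

section \<open>The adjunction\<close>

lemma functor_simps:
  "on_obj cone_functor A = (fst A, induced_cone (fst A) (snd A))" "on_hom cone_functor A B f = f"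
  "on_obj rel_functor K = (fst K, induced_relation (fst K) (snd K))" "on_hom rel_functor K K' h = h"
  by (simp_all add: cone_functor_def rel_functor_def split_beta)

lemma comp_id_functor_simps:
  "on_obj (comp_functor G F) A = on_obj G (on_obj F A)"
  "on_hom (comp_functor G F) A B f = on_hom G (on_obj F A) (on_obj F B) (on_hom F A B f)"
  "on_obj id_functor A = A" "on_hom id_functor A B f = f"
  by (simp_all add: comp_functor_def id_functor_def)

section \<open>Functoriality of cone and of rel\<close>

lemma is_functor_cone: "is_functor rosLoc (opposite conicFrm) cone_functor"
  unfolding is_functor_def opposite_simps functor_simps
proof (intro conjI ballI is_category_rosLoc is_category_opposite is_category_conicFrm)
  fix A :: "'a gorder \<times> 'a lrel" assume "A \<in> Obj rosLoc"
  then show "(fst A, induced_cone (fst A) (snd A)) \<in> Obj conicFrm"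
    by (simp add: rosLoc_simps conicFrm_simps open_localic_relation.conic_frame_cone)
next
  fix A B :: "'a gorder \<times> 'a lrel" and f
  assume "A \<in> Obj rosLoc" "B \<in> Obj rosLoc" "f \<in> Hom rosLoc A B"
  then show "f \<in> Hom conicFrm (fst B, induced_cone (fst B) (snd B)) (fst A, induced_cone (fst A) (snd A))"
    using rosLoc_homs[of f A B] by (simp add: rosLoc_simps conicFrm_simps monotone_map_cone)
qed (simp_all add: rosLoc_simps conicFrm_simps)

lemma is_functor_rel: "is_functor (opposite conicFrm) rosLoc rel_functor"
  unfolding is_functor_def opposite_simps functor_simps
proof (intro conjI ballI is_category_rosLoc is_category_opposite is_category_conicFrm)
  fix A :: "'a gorder \<times> ('a \<Rightarrow> 'a)" assume "A \<in> Obj conicFrm"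
  then interpret conic "fst A" "snd A"
    by (intro conicI) (simp add: conicFrm_simps)
  show "(fst A, induced_relation (fst A) (snd A)) \<in> Obj rosLoc"
    by (simp add: rosLoc_simps open_localic_relation_axioms)
next
  fix A B :: "'a gorder \<times> ('a \<Rightarrow> 'a)" and f
  assume "A \<in> Obj conicFrm" "B \<in> Obj conicFrm" "f \<in> Hom conicFrm B A"
  then show "f \<in> Hom rosLoc (fst A, induced_relation (fst A) (snd A)) (fst B, induced_relation (fst B) (snd B))"
    by (simp add: rosLoc_simps conicFrm_simps monotone_map_induced)
qed (simp_all add: rosLoc_simps conicFrm_simps)

lemma cone_rel_obj:
  assumes "K \<in> Obj conicFrm"
  shows "on_obj cone_functor (on_obj rel_functor K) = K"
proof -
  interpret conic "fst K" "snd K"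
    using assms by (intro conicI) (simp add: conicFrm_simps)
  show ?thesis
    by (simp add: functor_simps cone_induced_relation)
qed

theorem theorem4p23:
  shows "\<exists>(\<eta> :: 'a gorder \<times> 'a lrel \<Rightarrow> 'a \<Rightarrow> 'a) \<epsilon>.
     is_adjunction rosLoc (opposite conicFrm) cone_functor rel_functor \<eta> \<epsilon> \<and>
     functors_agree (opposite conicFrm) (comp_functor cone_functor rel_functor) id_functor \<and>
     (\<forall>A\<in>Obj (opposite conicFrm). \<epsilon> A = Ident (opposite conicFrm) A)"
proof (intro exI conjI)
  \<comment> \<open>Arrows do not determine their codomain, so the identity function of
    \<open>A\<close> can also serve as an arrow from \<open>A\<close> to rel of cone of
    \<open>A\<close>; only its monotonicity has to be shown.\<close>
  let ?\<eta> = "Ident rosLoc :: 'a gorder \<times> 'a lrel \<Rightarrow> 'a \<Rightarrow> 'a"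
  let ?\<epsilon> = "Ident (opposite conicFrm) :: 'a gorder \<times> ('a \<Rightarrow> 'a) \<Rightarrow> 'a \<Rightarrow> 'a"
  have unit_hom: "?\<eta> A \<in> Hom rosLoc A (on_obj rel_functor (on_obj cone_functor A))"
    if A: "A \<in> Obj rosLoc" for A :: "'a gorder \<times> 'a lrel"
  proof -
    interpret open_localic_relation "fst A" "snd A"
      using A by (simp add: rosLoc_simps)
    interpret cone: conic "fst A" cone
      by (rule conicI[OF conic_frame_cone])
    show ?thesis
      using monotone_map_id[OF localic_relation_axioms cone.localic_relation_axioms
          induced_relation_cone_subset]
      by (simp add: rosLoc_simps functor_simps)
  qed
  have Ident_comp: "compose (carrier (fst B)) f (\<lambda>x\<in>carrier (fst B). x) = f"
      "compose (carrier (fst B)) (\<lambda>x\<in>carrier (fst A). x) f = f"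
    if "f \<in> Hom rosLoc A B" for A B :: "'a gorder \<times> 'a lrel" and f
    using frame_homs_compose_id[OF rosLoc_homs[OF that]] by auto
  have conic_category: "is_category (opposite conicFrm :: ('a gorder \<times> ('a \<Rightarrow> 'a), 'a \<Rightarrow> 'a) cat_data)"
    by (intro is_category_opposite is_category_conicFrm)
  show "is_adjunction rosLoc (opposite conicFrm) cone_functor rel_functor ?\<eta> ?\<epsilon>"
    unfolding is_adjunction_def
  proof (intro conjI ballI is_functor_cone is_functor_rel)
    show "is_natural rosLoc rosLoc id_functor (comp_functor rel_functor cone_functor) ?\<eta>"
      unfolding is_natural_def comp_id_functor_simps
    proof (intro conjI ballI unit_hom)
      fix A B :: "'a gorder \<times> 'a lrel" and f assume "f \<in> Hom rosLoc A B"
      then show "Comp rosLoc A B (on_obj rel_functor (on_obj cone_functor B)) (?\<eta> B) f =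
        Comp rosLoc A (on_obj rel_functor (on_obj cone_functor A)) (on_obj rel_functor (on_obj cone_functor B))
          (on_hom rel_functor (on_obj cone_functor A) (on_obj cone_functor B) (on_hom cone_functor A B f))
          (?\<eta> A)"
        by (simp add: rosLoc_simps(3,4) functor_simps Ident_comp[of f A B])
    qed
    \<comment> \<open>Once cone after rel is known to fix objects, naturality is the identity law of
      the opposite category.\<close>
    show "is_natural (opposite conicFrm) (opposite conicFrm)
        (comp_functor cone_functor rel_functor) id_functor ?\<epsilon>"
      using conic_category unfolding is_natural_def is_category_def comp_id_functor_simps
      by (simp add: cone_rel_obj opposite_simps(1)) (simp add: functor_simps)
  next
    fix A :: "'a gorder \<times> 'a lrel" assume "A \<in> Obj rosLoc"
    then have "complete_lattice (fst A)"
      using frame.complete_lattice by (auto simp: rosLoc_simps open_localic_relation_def localic_relation_def)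
    \<comment> \<open>In each triangle identity the composite is the identity function of the
      underlying frame composed with itself.\<close>
    from frame_homs_compose_id(1)[OF id_frame_homs[OF this]]
    show "Comp (opposite conicFrm) (on_obj cone_functor A)
        (on_obj cone_functor (on_obj rel_functor (on_obj cone_functor A))) (on_obj cone_functor A)
        (?\<epsilon> (on_obj cone_functor A))
        (on_hom cone_functor A (on_obj rel_functor (on_obj cone_functor A)) (?\<eta> A)) =
      Ident (opposite conicFrm) (on_obj cone_functor A)"
      by (simp add: opposite_simps conicFrm_simps rosLoc_simps functor_simps)
  next
    fix B :: "'a gorder \<times> ('a \<Rightarrow> 'a)" assume "B \<in> Obj (opposite conicFrm)"
    then have "complete_lattice (fst B)"
      using frame.complete_lattice by (auto simp: opposite_simps conicFrm_simps conic_frame_def)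
    from frame_homs_compose_id(1)[OF id_frame_homs[OF this]]
    show "Comp rosLoc (on_obj rel_functor B)
        (on_obj rel_functor (on_obj cone_functor (on_obj rel_functor B))) (on_obj rel_functor B)
        (on_hom rel_functor (on_obj cone_functor (on_obj rel_functor B)) B (?\<epsilon> B))
        (?\<eta> (on_obj rel_functor B)) =
      Ident rosLoc (on_obj rel_functor B)"
      by (simp add: opposite_simps conicFrm_simps rosLoc_simps functor_simps)
  qed
  show "functors_agree (opposite conicFrm) (comp_functor cone_functor rel_functor) id_functor"
    by (simp add: functors_agree_def comp_id_functor_simps opposite_simps cone_rel_obj functor_simps(2,4))
qed simp

end
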